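(* Let $(P_n(x))_{n\in\mathbb{N}_0}$ be a random walk polynomial sequence with recurrence coefficients $(c_n)_{n\in\mathbb{N}}\subseteq(0,1)$ and orthogonalization measure $\mu$. If $k\geq2$ is an integer, then the following are equivalent: (i) $(P_n(x))_{n\in\mathbb{N}_0}$ is $k$-sieved, (ii) $\mathrm{D}_kP_n(x)=\mathrm{D}_kP_n(1)\,P_{n-1}^{\ast}(x)$ for all $n\in\mathbb{N}$, (iii) for all $n\geq2$, $\left(1-x^2\right)\mathrm{D}_kP_n(x)$ is orthogonal (with respect to $\mu$) to $P_0(x),\ldots,P_{n-2}(x)$, (iv) one has $$\kappa_{n+2}(n-1;k)=\sigma(n+2;k),\qquad n\in\mathbb{N},$$ and for every $n\in\mathbb{N}$ there is an $m\in\{0,\ldots,\lfloor(n-1)/2\rfloor\}$ such that $$\kappa_{n+4}(n-1-2m;k)=\sigma(n+4;k).$$ If $k=1$, then (ii), (iii) and (iv) are equivalent to (i') $P_n(x)=P_n^{(1/(2c_1)-3/2)}(x)$ for all $n\in\mathbb{N}_0$.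
   Context: $\mathbb{N}=\{1,2,\ldots\}$, $\mathbb{N}_0=\mathbb{N}\cup\{0\}$. An orthogonalization measure is a symmetric probability Borel measure $\mu$ on $\mathbb{R}$ with $|\mathsf{supp}\,\mu|=\infty$ and $\mathsf{supp}\,\mu\subseteq[-1,1]$. The random walk polynomial sequence (RWPS) with respect to $\mu$ is the sequence $(P_n(x))_{n\in\mathbb{N}_0}\subseteq\mathbb{R}[x]$ ($\deg P_n=n$) of polynomials orthogonal with respect to $\mu$, normalized by $P_n(1)=1$, $n\in\mathbb{N}_0$. It is well known that RWPS are exactly the sequences given by $P_0(x)=1$ and $xP_n(x)=a_nP_{n+1}(x)+c_nP_{n-1}(x)$, $n\in\mathbb{N}_0$, with $c_0:=0$, $(c_n)_{n\in\mathbb{N}}\subseteq(0,1)$ and $a_n:=1-c_n$, $n\in\mathbb{N}_0$ (the term $c_0P_{-1}(x)$ is read as $0$), and that the orthogonalization measure $\mu$ is uniquely determined by the RWPS. An RWPS $(P_n(x))_{n\in\mathbb{N}_0}$ is called $k$-sieved if $c_n=\frac12$ for every $n\in\mathbb{N}$ with $k\nmid n$ (equivalently, there is an RWPS with recurrence coefficients $(\tilde c_n)_{n\in\mathbb{N}}\subseteq(0,1)$ such that $c_n=\tilde c_{n/k}$ if $k\mid n$ and $c_n=\frac12$ otherwise). $(P_n^{\ast}(x))_{n\in\mathbb{N}_0}\subseteq\mathbb{R}[x]$ ($\deg P_n^{\ast}=n$) denotes the polynomials orthogonal with respect to $\mathrm{d}\mu^{\ast}(x):=(1-x^2)\,\mathrm{d}\mu(x)$,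 normalized by $P_n^{\ast}(1)=1$, $n\in\mathbb{N}_0$. $(T_n(x))_{n\in\mathbb{N}_0}$ and $(U_n(x))_{n\in\mathbb{N}_0}$ are the Chebyshev polynomials of the first and second kind, $T_n(\cos\theta)=\cos(n\theta)$, $U_n(\cos\theta)=\sin((n+1)\theta)/\sin\theta$, and $U_{-1}(x):=0$. For $k\in\mathbb{N}$, the sieved Askey--Wilson operator $\mathrm{D}_k\colon\mathbb{R}[x]\to\mathbb{R}[x]$ is the linear operator determined by $\mathrm{D}_kT_n(x)=U_{n-1}\left(\left|\cos\left(\frac{\pi}{k}\right)\right|\right)U_{n-1}(x)$, $n\in\mathbb{N}_0$. $\mathrm{D}_kP_n(1)$ denotes the value of the polynomial $\mathrm{D}_kP_n(x)$ at $x=1$. For $n,j\in\mathbb{N}_0$, $\kappa_n(j;k):=\int_{\mathbb{R}}\mathrm{D}_kP_n(x)\,P_j(x)\,\mathrm{d}\mu(x)$, and for $n\in\mathbb{N}$, $\sigma(n;k):=\kappa_n(n-1;k)$. For $\alpha>-1$, $(P_n^{(\alpha)}(x))_{n\in\mathbb{N}_0}$ denotes the ultraspherical polynomials normalized by $P_n^{(\alpha)}(1)=1$, i.e. the RWPS orthogonal with respect to the probability measure $\frac{\Gamma(2\alpha+2)}{2^{2\alpha+1}\Gamma(\alpha+1)^2}(1-x^2)^{\alpha}\chi_{(-1,1)}(x)\,\mathrm{d}x$; its recurrence coefficients are $c_n=\frac{n}{2n+2\alpha+1}$, $n\in\mathbb{N}$. *)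

theory Defs
  imports "HOL-Probability.Probability" "HOL-Computational_Algebra.Polynomial"
begin

definition supp :: "real measure \<Rightarrow> real set" where
  "supp \<mu> = {x. \<forall>U. open U \<and> x \<in> U \<longrightarrow> emeasure \<mu> U > 0}"

definition orthogonalization_measure :: "real measure \<Rightarrow> bool" where
  "orthogonalization_measure \<mu> \<longleftrightarrow>
     prob_space \<mu> \<and> sets \<mu> = sets borel \<and> distr \<mu> borel uminus = \<mu> \<and>
     infinite (supp \<mu>) \<and> supp \<mu> \<subseteq> {-1..1}"

definition normalized_ops :: "real measure \<Rightarrow> (nat \<Rightarrow> real poly) \<Rightarrow> bool" where
  "normalized_ops \<nu> P \<longleftrightarrow>
     (\<forall>n. degree (P n) = n) \<and> (\<forall>n. poly (P n) 1 = 1) \<and>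
     (\<forall>m n. m \<noteq> n \<longrightarrow> (\<integral>x. poly (P m) x * poly (P n) x \<partial>\<nu>) = 0)"

(* To be used only for finite Borel measures with infinite support in [-1,1];
   for these, exactly one sequence satisfies normalized_ops. *)
definition ops :: "real measure \<Rightarrow> nat \<Rightarrow> real poly" where
  "ops \<nu> = (THE P. normalized_ops \<nu> P)"

definition rwps :: "real measure \<Rightarrow> (nat \<Rightarrow> real poly) \<Rightarrow> bool" where
  "rwps \<mu> P \<longleftrightarrow> orthogonalization_measure \<mu> \<and> normalized_ops \<mu> P"

(* For n = 0 the last summand vanishes because c 0 = 0, whatever P (0 - 1) is. *)
definition recurrence_coeffs :: "(nat \<Rightarrow> real poly) \<Rightarrow> (nat \<Rightarrow> real) \<Rightarrow> bool" where
  "recurrence_coeffs P c \<longleftrightarrow>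
     c 0 = 0 \<and> (\<forall>n\<ge>1. 0 < c n \<and> c n < 1) \<and> P 0 = 1 \<and>
     (\<forall>n. [:0, 1:] * P n = smult (1 - c n) (P (n + 1)) + smult (c n) (P (n - 1)))"

(* A property of an RWPS, expressed through its recurrence coefficients. *)
definition sieved :: "nat \<Rightarrow> (nat \<Rightarrow> real) \<Rightarrow> bool" where
  "sieved k c \<longleftrightarrow> (\<forall>n\<ge>1. \<not> k dvd n \<longrightarrow> c n = 1 / 2)"

(* The truncation of 1 - x^2 by ennreal only affects the complement of [-1,1],
   which is a null set for every orthogonalization measure. *)
definition star_measure :: "real measure \<Rightarrow> real measure" where
  "star_measure \<mu> = density \<mu> (\<lambda>x. ennreal (1 - x\<^sup>2))"

definition star_polys :: "real measure \<Rightarrow> nat \<Rightarrow> real poly" where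
  "star_polys \<mu> = ops (star_measure \<mu>)"

fun cheb_T :: "nat \<Rightarrow> real poly" where
  "cheb_T 0 = 1"
| "cheb_T (Suc 0) = [:0, 1:]"
| "cheb_T (Suc (Suc n)) = [:0, 2:] * cheb_T (Suc n) - cheb_T n"

fun cheb_U :: "nat \<Rightarrow> real poly" where
  "cheb_U 0 = 1"
| "cheb_U (Suc 0) = [:0, 2:]"
| "cheb_U (Suc (Suc n)) = [:0, 2:] * cheb_U (Suc n) - cheb_U n"

lemma poly_cheb_T_cos: "poly (cheb_T n) (cos \<theta>) = cos (real n * \<theta>)"
proof (induction n rule: cheb_T.induct)
  case (3 n)
  have "cos (real (Suc (Suc n)) * \<theta>) = cos (real (Suc n) * \<theta> + \<theta>)"
    and "cos (real n * \<theta>) = cos (real (Suc n) * \<theta> - \<theta>)"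
    by (simp_all add: algebra_simps)
  with 3 show ?case by (simp add: cos_add cos_diff)
qed simp_all

lemma poly_cheb_U_cos: "poly (cheb_U n) (cos \<theta>) * sin \<theta> = sin (real (n + 1) * \<theta>)"
proof (induction n rule: cheb_U.induct)
  case 2
  show ?case using sin_double[of \<theta>] by simp
next
  case (3 n)
  have "sin (real (Suc (Suc n) + 1) * \<theta>) = sin (real (Suc n + 1) * \<theta> + \<theta>)"
    and *: "sin (real (n + 1) * \<theta>) = sin (real (Suc n + 1) * \<theta> - \<theta>)"
    by (simp_all add: algebra_simps)
  then have "sin (real (Suc (Suc n) + 1) * \<theta>)
      = 2 * cos \<theta> * sin (real (Suc n + 1) * \<theta>) - sin (real (n + 1) * \<theta>)"
    unfolding * by (simp add: sin_add sin_diff)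
  also have "\<dots> = poly (cheb_U (Suc (Suc n))) (cos \<theta>) * sin \<theta>"
    unfolding 3[symmetric] by (simp add: algebra_simps)
  finally show ?case by simp
qed simp_all

lemma degree_cheb_T: "degree (cheb_T n) = n"
proof (induction n rule: cheb_T.induct)
  case (3 n)
  have "cheb_T (Suc n) \<noteq> 0" using 3(1) by fastforce
  then have "degree ([:0, 2:] * cheb_T (Suc n)) = Suc (Suc n)"
    using 3(1) by (subst degree_mult_eq) auto
  moreover have "degree (- cheb_T n) < Suc (Suc n)" using 3(2) by simp
  ultimately have "degree ([:0, 2:] * cheb_T (Suc n) + - cheb_T n) = Suc (Suc n)"
    by (subst degree_add_eq_left) simp_all
  then show ?case by simp
qed simp_all

(* The case n = 0 is the convention U_{-1} = 0. *)
definition askey_wilson_spec :: "nat \<Rightarrow> (real poly \<Rightarrow> real poly) \<Rightarrow> bool" where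
  "askey_wilson_spec k D \<longleftrightarrow> Vector_Spaces.linear smult smult D \<and>
     (\<forall>n. D (cheb_T n) =
        (if n = 0 then 0
         else smult (poly (cheb_U (n - 1)) \<bar>cos (pi / real k)\<bar>) (cheb_U (n - 1))))"

definition askey_wilson :: "nat \<Rightarrow> real poly \<Rightarrow> real poly" where
  "askey_wilson k = (THE D. askey_wilson_spec k D)"

lemma linear_smult_iff:
  "Vector_Spaces.linear smult smult D \<longleftrightarrow>
     (\<forall>p q. D (p + q) = D p + D q) \<and> (\<forall>(a::real) p. D (smult a p) = smult a (D p))"
proof -
  interpret vector_space "smult :: real \<Rightarrow> real poly \<Rightarrow> real poly"
    by unfold_locales (simp_all add: smult_add_right smult_add_left)
  have "vector_space (smult :: real \<Rightarrow> real poly \<Rightarrow> real poly)"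
    by unfold_locales
  then show ?thesis by (simp add: Vector_Spaces.linear_iff)
qed

lemma ex1_linear_on_graded_basis:
  fixes T f :: "nat \<Rightarrow> real poly"
  assumes deg: "\<And>n. degree (T n) = n" and nz: "T 0 \<noteq> 0"
  shows "\<exists>!D. Vector_Spaces.linear smult smult D \<and> (\<forall>n. D (T n) = f n)"
proof -
  have nzT: "T n \<noteq> 0" for n using deg[of n] nz by (cases n) auto
  have lc: "coeff (T n) n \<noteq> 0" for n using nzT[of n] deg[of n] leading_coeff_0_iff by metis
  define G where "G = wfrec less_than (\<lambda>g n. smult (inverse (coeff (T n) n))
      (f n - (\<Sum>i<n. smult (coeff (T n) i) (g i))))"
  have G: "G n = smult (inverse (coeff (T n) n)) (f n - (\<Sum>i<n. smult (coeff (T n) i) (G i)))" for n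
  proof -
    have "(\<Sum>i<n. smult (coeff (T n) i) (cut G less_than n i)) = (\<Sum>i<n. smult (coeff (T n) i) (G i))"
      by (intro sum.cong) (auto simp: cut_apply)
    then show ?thesis
      by (subst G_def, subst wfrec[OF wf_less_than], fold G_def) simp
  qed
  define L where "L p = (\<Sum>i\<le>degree p. smult (coeff p i) (G i))" for p
  have L: "L p = (\<Sum>i\<le>m. smult (coeff p i) (G i))" if "degree p \<le> m" for p m
    unfolding L_def by (rule sum.mono_neutral_left) (use that in \<open>auto simp: coeff_eq_0\<close>)
  have add: "L (p + q) = L p + L q" for p q
  proof -
    let ?m = "max (degree p) (degree q)"
    have "degree (p + q) \<le> ?m" by (rule degree_add_le_max)
    then show ?thesis
      by (simp add: L[of _ ?m] smult_add_left sum.distrib)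
  qed
  have smul: "L (smult a p) = smult a (L p)" for a p
  proof (cases "a = 0")
    case False
    have "smult a (\<Sum>i\<in>A. g i) = (\<Sum>i\<in>A. smult a (g i))" for A and g :: "nat \<Rightarrow> real poly"
      by (induction A rule: infinite_finite_induct) (simp_all add: smult_add_right)
    with False show ?thesis by (simp add: L_def)
  qed (simp add: L_def)
  have LT: "L (T n) = f n" for n
  proof -
    have "L (T n) = (\<Sum>i<n. smult (coeff (T n) i) (G i)) + smult (coeff (T n) n) (G n)"
      by (simp add: L_def deg lessThan_Suc_atMost[symmetric])
    also have "smult (coeff (T n) n) (G n) = f n - (\<Sum>i<n. smult (coeff (T n) i) (G i))"
      by (subst G) (use lc[of n] in simp)
    finally show ?thesis by simp
  qed
  show ?thesis
  proof (rule ex1I[of _ L])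
    show "Vector_Spaces.linear smult smult L \<and> (\<forall>n. L (T n) = f n)"
      using add smul LT by (simp add: linear_smult_iff)
  next
    fix D assume D: "Vector_Spaces.linear smult smult D \<and> (\<forall>n. D (T n) = f n)"
    then have Da: "D (p + q) = D p + D q" and Ds: "D (smult a p) = smult a (D p)" for p q a
      by (simp_all add: linear_smult_iff)
    have D0: "D 0 = 0" using Ds[of 0 0] by simp
    have L0: "L 0 = 0" by (simp add: L_def)
    have "D p = L p" if "p = 0 \<or> degree p < n" for p n
      using that
    proof (induction n arbitrary: p)
      case 0
      then show ?case by (simp add: D0 L0)
    next
      case (Suc n)
      show ?case
      proof (cases "degree p = n")
        case False
        with Suc show ?thesis by auto
      next
        case True
        define a where "a = coeff p n / coeff (T n) n"
        define r where "r = p - smult a (T n)"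
        have "degree r \<le> n"
          unfolding r_def by (rule degree_diff_le) (use True deg in \<open>auto intro: order.trans[OF degree_smult_le]\<close>)
        moreover have "coeff r n = 0"
          using lc[of n] by (simp add: r_def a_def)
        ultimately have "r = 0 \<or> degree r < n"
          using leading_coeff_0_iff[of r] by (cases "degree r = n") auto
        then have r: "D r = L r" by (rule Suc.IH)
        have p: "p = r + smult a (T n)" by (simp add: r_def)
        have "D (r + smult a (T n)) = L (r + smult a (T n))"
          by (simp add: Da Ds add smul r LT D)
        then show ?thesis using p by simp
      qed
    qed
    then show "D = L" by blast
  qed
qed

lemma askey_wilson_spec_askey_wilson: "askey_wilson_spec k (askey_wilson k)"
proof -
  have "\<exists>!D. askey_wilson_spec k D"
    unfolding askey_wilson_spec_def
    by (rule ex1_linear_on_graded_basis) (simp_all add: degree_cheb_T)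
  from theI'[OF this] show ?thesis by (simp add: askey_wilson_def)
qed

definition kappa_coeff :: "real measure \<Rightarrow> (nat \<Rightarrow> real poly) \<Rightarrow> nat \<Rightarrow> nat \<Rightarrow> nat \<Rightarrow> real" where
  "kappa_coeff \<mu> P k n j = (\<integral>x. poly (askey_wilson k (P n)) x * poly (P j) x \<partial>\<mu>)"

definition sigma_coeff :: "real measure \<Rightarrow> (nat \<Rightarrow> real poly) \<Rightarrow> nat \<Rightarrow> nat \<Rightarrow> real" where
  "sigma_coeff \<mu> P k n = kappa_coeff \<mu> P k n (n - 1)"

(* Meaningful for \<alpha> > -1 only. *)
definition ultraspherical_measure :: "real \<Rightarrow> real measure" where
  "ultraspherical_measure \<alpha> = density lborel (\<lambda>x. ennreal
     (Gamma (2 * \<alpha> + 2) / (2 powr (2 * \<alpha> + 1) * (Gamma (\<alpha> + 1))\<^sup>2)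
        * (1 - x\<^sup>2) powr \<alpha> * indicator {-1<..<1} x))"

definition ultraspherical :: "real \<Rightarrow> nat \<Rightarrow> real poly" where
  "ultraspherical \<alpha> = ops (ultraspherical_measure \<alpha>)"

end

theory Submission
  imports Defs
begin

text \<open>
  Write \<open>L p\<close> for the integral of \<open>p\<close>, \<open>D\<close> for the sieved Askey--Wilson operator, \<open>\<alpha> = \<bar>cos (\<pi> / k)\<bar>\<close>
  and \<open>\<kappa> n j = L (D (P n) * P j)\<close>.  The operator enters only through the quadratic commutation relation
  with the multiplication by \<open>x\<close> in lemma \<open>D_commutation\<close>.  Tested against the sequence itself, it
  becomes a local recurrence for the array \<open>\<kappa>\<close> (lemma \<open>\<kappa>_rec\<close>), and the rest is about this recurrence.
  It yields that \<open>\<kappa> n j\<close> vanishes for \<open>j \<ge> n\<close> and for even \<open>n + j\<close>, and the values \<open>\<sigma> n = \<kappa> n (n - 1)\<close>.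

  The polynomials for the weight multiplied by \<open>1 - x\<^sup>2\<close> are partial Christoffel kernels at \<open>1\<close>, hence
  their Fourier coefficients up to the degree are constant on one parity class.  So \<open>D (P n)\<close> is a multiple of such a
  polynomial if and only if its row is flat, that is \<open>\<kappa> n j = \<sigma> n\<close> for all \<open>j < n\<close> with \<open>n + j\<close> odd.
  The same flatness expresses the orthogonality condition, because multiplication by \<open>1 - x\<^sup>2\<close> acts on
  the coefficients of one parity as a second difference.

  It remains to see which recurrence coefficients make all rows flat.  The rows can be computed one
  after the other, and flatness of the next row amounts to one equation for its second coefficient and
  one for all the lower ones (lemmas \<open>second_coefficient\<close> and \<open>lower_coefficient\<close>).  Both hold
  for sieved coefficients, and for \<open>c n = n / (2 n + s)\<close> if \<open>k = 1\<close>.  Conversely, flatness of the second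
  coefficients alone is a nonlinear second order equation for \<open>d n = c n - 1 / 2\<close> which, thanks to
  \<open>d 0 = - 1 / 2\<close>, has a first integral (lemma \<open>first_integral\<close>).  For \<open>k = 1\<close> it solves the equation.
  For \<open>k \<ge> 3\<close> it degenerates next to the multiples of \<open>k\<close>; there \<open>0 < c n\<close> forces \<open>d = 0\<close>, and the zeros
  spread over all indices that are not multiples of \<open>k\<close>.  For \<open>k = 2\<close> the equation leaves an
  alternative, and a further coefficient of each row excludes the wrong branch.

  For \<open>k = 1\<close> flatness turns into a recurrence for the moments of \<open>L\<close> which integration by parts gives
  for the ultraspherical measure as well.  Applied to the functional that Favard's theorem attaches to
  \<open>c n = n / (2 n + s)\<close>, this identifies the ultraspherical polynomials by their recurrence coefficients.
\<close>

section \<open>Expansions in a graded basis of polynomials\<close>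

lemma graded_basis_expansion:
  fixes Q :: "nat \<Rightarrow> real poly"
  assumes deg: "\<And>n. degree (Q n) = n" and nz: "Q 0 \<noteq> 0" and "degree p \<le> n"
  shows "\<exists>f. p = (\<Sum>j\<le>n. smult (f j) (Q j))"
  using \<open>degree p \<le> n\<close>
proof (induction n arbitrary: p)
  case 0
  obtain a where a: "p = [:a:]" using 0 by (auto elim: degree_eq_zeroE)
  obtain b where b: "Q 0 = [:b:]" using deg[of 0] by (auto elim: degree_eq_zeroE)
  have "b \<noteq> 0" using b nz by auto
  then have "p = (\<Sum>j\<le>(0::nat). smult (a / b) (Q j))" using a b by simp
  then show ?case by (intro exI[of _ "\<lambda>_. a / b"])
next
  case (Suc n)
  have lc: "coeff (Q (Suc n)) (Suc n) \<noteq> 0"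
    using deg[of "Suc n"] leading_coeff_0_iff[of "Q (Suc n)"] by (metis degree_0 nat.distinct(1))
  define b where "b = coeff p (Suc n) / coeff (Q (Suc n)) (Suc n)"
  define r where "r = p - smult b (Q (Suc n))"
  have "degree r \<le> Suc n" unfolding r_def
    by (rule degree_diff_le) (use Suc.prems deg in \<open>auto intro: order.trans[OF degree_smult_le]\<close>)
  moreover have "coeff r (Suc n) = 0" using lc by (simp add: r_def b_def)
  ultimately have "degree r \<le> n"
    by (metis le_SucE leading_coeff_0_iff degree_0 le0)
  then obtain f where f: "r = (\<Sum>j\<le>n. smult (f j) (Q j))" using Suc.IH by blast
  have "p = r + smult b (Q (Suc n))" by (simp add: r_def)
  also have "r = (\<Sum>j\<le>n. smult ((f(Suc n := b)) j) (Q j))"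
    unfolding f by (intro sum.cong) auto
  finally have "p = (\<Sum>j\<le>Suc n. smult ((f(Suc n := b)) j) (Q j))" by simp
  then show ?case by blast
qed

lemma graded_basis_induct [consumes 2, case_names add smult basis]:
  fixes Q :: "nat \<Rightarrow> real poly"
  assumes deg: "\<And>n. degree (Q n) = n" and nz: "Q 0 \<noteq> 0"
    and add: "\<And>p q. Pr p \<Longrightarrow> Pr q \<Longrightarrow> Pr (p + q)"
    and sm: "\<And>a p. Pr p \<Longrightarrow> Pr (smult a p)"
    and basis: "\<And>n. Pr (Q n)"
  shows "Pr p"
proof -
  obtain f where f: "p = (\<Sum>j\<le>degree p. smult (f j) (Q j))"
    using graded_basis_expansion[OF deg nz order_refl] by blast
  have "Pr (\<Sum>j\<le>n. smult (f j) (Q j))" for n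
    by (induction n) (auto intro: add sm basis)
  with f show ?thesis by metis
qed

text \<open>An orthogonal sequence with prescribed degrees and prescribed value at a point is unique as
  soon as one such sequence has non-zero square norms: expanding any other one in it, all
  coefficients but the top one vanish.\<close>

lemma orthogonal_sequence_unique:
  fixes \<Lambda> :: "real poly \<Rightarrow> real" and Q R :: "nat \<Rightarrow> real poly"
  assumes add: "\<And>p q. \<Lambda> (p + q) = \<Lambda> p + \<Lambda> q" and sm: "\<And>a p. \<Lambda> (smult a p) = a * \<Lambda> p"
    and Q: "\<And>n. degree (Q n) = n" "\<And>n. poly (Q n) 1 = 1" "\<And>m n. m \<noteq> n \<Longrightarrow> \<Lambda> (Q m * Q n) = 0"
    and R: "\<And>n. degree (R n) = n" "\<And>n. poly (R n) 1 = 1" "\<And>m n. m \<noteq> n \<Longrightarrow> \<Lambda> (R m * R n) = 0"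
    and norm: "\<And>n. \<Lambda> (R n * R n) \<noteq> 0"
  shows "Q = R"
proof
  fix n
  have zero: "\<Lambda> 0 = 0" using sm[of 0 0] by simp
  have lsum: "\<Lambda> (\<Sum>j\<in>A. g j) = (\<Sum>j\<in>A. \<Lambda> (g j))" for A and g :: "nat \<Rightarrow> real poly"
    by (induction A rule: infinite_finite_induct) (simp_all add: zero add)
  have nz: "Q 0 \<noteq> 0" "R 0 \<noteq> 0" using Q(2)[of 0] R(2)[of 0] by auto
  have low: "\<Lambda> (Q n * R j) = 0" if "j < n" for j
  proof -
    obtain f where f: "R j = (\<Sum>i\<le>j. smult (f i) (Q i))"
      using graded_basis_expansion[of Q "R j" j, OF Q(1) nz(1)] R(1) by auto
    show ?thesis unfolding f
      using that by (simp add: sum_distrib_left lsum sm Q(3))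
  qed
  obtain f where f: "Q n = (\<Sum>i\<le>n. smult (f i) (R i))"
    using graded_basis_expansion[of R "Q n" n, OF R(1) nz(2)] Q(1) by auto
  have "f j = 0" if "j < n" for j
  proof -
    have "\<Lambda> (Q n * R j) = (\<Sum>i\<le>n. f i * \<Lambda> (R i * R j))"
      unfolding f by (simp add: sum_distrib_right lsum sm)
    also have "\<dots> = (\<Sum>i\<le>n. if i = j then f j * \<Lambda> (R j * R j) else 0)"
      by (intro sum.cong) (auto simp: R(3))
    also have "\<dots> = f j * \<Lambda> (R j * R j)" using that by simp
    finally show ?thesis using low[OF that] norm[of j] by simp
  qed
  then have "Q n = smult (f n) (R n)"
    by (subst f) (simp add: lessThan_Suc_atMost[symmetric])
  moreover have "f n = 1" using Q(2)[of n] R(2)[of n] calculation by simp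
  ultimately show "Q n = R n" by simp
qed

definition pX :: "real poly" where "pX = [:0, 1:]"

lemma poly_pX [simp]: "poly pX x = x" by (simp add: pX_def)

lemma one_minus_sq_times: "[:1, 0, -1:] * p = p - pX * (pX * p)"
  by (simp add: pX_def)

section \<open>The sieved Askey--Wilson operator\<close>

text \<open>\<open>U\<^sub>n\<^sub>-\<^sub>1\<close>, shifted so that the convention \<open>U\<^sub>-\<^sub>1 = 0\<close> needs no case distinction.\<close>

definition cheb_u :: "nat \<Rightarrow> real poly" where
  "cheb_u n = (if n = 0 then 0 else cheb_U (n - 1))"

lemma cheb_u_simps [simp]:
  "cheb_u 0 = 0" "cheb_u (Suc 0) = 1"
  "cheb_u (Suc (Suc n)) = [:0, 2:] * cheb_u (Suc n) - cheb_u n"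
  by (cases n; simp add: cheb_u_def)+

locale chebyshev_parameter =
  fixes k :: nat
begin

text \<open>With \<open>\<phi> = \<pi> / k\<close> and \<open>k \<ge> 2\<close>: \<open>\<alpha> = cos \<phi>\<close>, \<open>\<gamma> n = sin (n \<phi>) / sin \<phi>\<close> and \<open>\<tau> n = cos (n \<phi>)\<close>.\<close>

definition \<alpha> :: real where "\<alpha> = \<bar>cos (pi / real k)\<bar>"
definition \<gamma> :: "nat \<Rightarrow> real" where "\<gamma> n = poly (cheb_u n) \<alpha>"
definition \<tau> :: "nat \<Rightarrow> real" where "\<tau> n = poly (cheb_T n) \<alpha>"
abbreviation D :: "real poly \<Rightarrow> real poly" where "D \<equiv> askey_wilson k"

lemma \<gamma>_simps [simp]: "\<gamma> 0 = 0" "\<gamma> (Suc 0) = 1"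
  and \<gamma>_rec: "\<gamma> (Suc (Suc n)) = 2 * \<alpha> * \<gamma> (Suc n) - \<gamma> n"
  by (simp_all add: \<gamma>_def)

lemma \<tau>_simps [simp]: "\<tau> 0 = 1" "\<tau> (Suc 0) = \<alpha>"
  and \<tau>_rec: "\<tau> (Suc (Suc n)) = 2 * \<alpha> * \<tau> (Suc n) - \<tau> n"
  by (simp_all add: \<tau>_def)

lemma two_\<tau>: "2 * \<tau> (Suc n) = \<gamma> (Suc (Suc n)) - \<gamma> n"
proof (induction n rule: induct_nat_012)
  case (ge2 n)
  have "2 * \<tau> (Suc (Suc (Suc n))) = 2 * \<alpha> * (2 * \<tau> (Suc (Suc n))) - 2 * \<tau> (Suc n)"
    by (simp add: \<tau>_rec)
  then show ?case unfolding ge2 by (simp add: \<gamma>_rec algebra_simps)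
qed (simp_all add: \<gamma>_rec \<tau>_rec algebra_simps)

lemma \<tau>_eq_\<gamma>: "\<tau> n = \<gamma> (Suc n) - \<alpha> * \<gamma> n"
proof (induction n rule: induct_nat_012)
  case (ge2 n)
  show ?case unfolding \<tau>_rec ge2 by (simp add: \<gamma>_rec algebra_simps)
qed (simp_all add: \<gamma>_rec)

lemma values_at_k_eq_1:
  assumes "k = 1"
  shows "\<alpha> = 1" and "\<gamma> n = real n" and "\<tau> n = 1"
proof -
  show \<alpha>: "\<alpha> = 1" unfolding \<alpha>_def by (simp add: assms)
  have "\<gamma> n = real n \<and> \<tau> n = 1"
    by (induction n rule: induct_nat_012) (simp_all add: \<gamma>_rec \<tau>_rec \<alpha>)
  then show "\<gamma> n = real n" "\<tau> n = 1" by simp_all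
qed

lemma D_add: "D (p + q) = D p + D q"
  and D_smult: "D (smult a p) = smult a (D p)"
  and D_cheb_T: "D (cheb_T n) = smult (\<gamma> n) (cheb_u n)"
  using askey_wilson_spec_askey_wilson[of k]
  by (auto simp: askey_wilson_spec_def linear_smult_iff \<gamma>_def \<alpha>_def cheb_u_def)

lemma D_one [simp]: "D 1 = 0" and D_X [simp]: "D pX = 1"
  using D_cheb_T[of 0] D_cheb_T[of 1] by (simp_all add: pX_def)

text \<open>In the variable \<open>\<theta>\<close> with \<open>x = cos \<theta>\<close>, and for \<open>k \<ge> 2\<close>, the operator is a difference quotient of the
  shifts by \<open>\<plusminus> \<pi> / k\<close>, and multiplication by \<open>x\<close> is a combination of the two exponentials
  \<open>exp (\<plusminus> \<i> \<theta>)\<close>, which a shift multiplies by \<open>exp (\<plusminus> \<i> \<pi> / k)\<close>, the roots of \<open>z\<^sup>2 - 2 \<alpha> z + 1\<close>.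
  Hence the quadratic relation.  For \<open>\<alpha> = 1\<close> it says that the second commutator of differentiation
  with multiplication by \<open>x\<close> vanishes.  It is linear in \<open>p\<close> and thus checked on the Chebyshev basis.\<close>

lemma D_commutation:
  "D (pX * (pX * p)) + pX * (pX * D p)
     = smult (2 * \<alpha>) (pX * D (pX * p)) + smult (1 - \<alpha>\<^sup>2) (D p)"
  (is "?l p = ?r p")
proof -
  have T: "pX * cheb_T (Suc n) = smult (1 / 2) (cheb_T (Suc (Suc n)) + cheb_T n)" for n
    by (simp add: pX_def smult_add_right smult_diff_right)
  have T0: "pX * cheb_T 0 = cheb_T (Suc 0)"
    by (simp add: pX_def)
  have "poly (?l (cheb_T n)) x = poly (?r (cheb_T n)) x" for n x
  proof -
    consider "n = 0" | "n = 1" | m where "n = Suc (Suc m)"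
      by (metis One_nat_def not0_implies_Suc)
    then show ?thesis
    proof cases
      case 1
      then show ?thesis
        unfolding 1 T0 T by (simp add: D_add D_smult D_cheb_T \<gamma>_rec algebra_simps power2_eq_square del: cheb_T.simps)
    next
      case 2
      then show ?thesis
        unfolding 2 One_nat_def T mult_smult_right distrib_left T0 
        by (simp add: D_add D_smult D_cheb_T \<gamma>_rec field_simps power2_eq_square del: cheb_T.simps)
    next
      case 3
      have \<gamma>3: "\<gamma> m = 2 * \<alpha> * \<gamma> (Suc m) - \<gamma> (Suc (Suc m))" by (simp add: \<gamma>_rec)
      show ?thesis
        unfolding 3 T mult_smult_right distrib_left 
        by (simp add: D_add D_smult D_cheb_T field_simps power2_eq_square del: cheb_T.simps)
           (simp add: \<gamma>_rec algebra_simps)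
    qed
  qed
  then have basis: "?l (cheb_T n) = ?r (cheb_T n)" for n
    by (intro poly_eq_poly_eq_iff[THEN iffD1] ext)
  have "cheb_T 0 \<noteq> 0" by simp
  from degree_cheb_T this show ?thesis
  proof (induction p rule: graded_basis_induct)
    case (add p q)
    have "?l (p + q) = ?l p + ?l q" by (simp only: distrib_left D_add add_ac)
    also have "\<dots> = ?r p + ?r q" by (simp only: add)
    also have "\<dots> = ?r (p + q)" by (simp only: distrib_left D_add smult_add_right add_ac)
    finally show ?case .
  next
    case (smult a p)
    have "?l (smult a p) = smult a (?l p)"
      by (simp add: D_smult smult_add_right)
    also have "\<dots> = ?r (smult a p)"
      by (simp only: smult) (simp add: D_smult smult_add_right mult.commute)
    finally show ?case .
  qed (rule basis)
qed

end

section \<open>Orthogonality from the recurrence\<close>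

locale rw_recurrence =
  fixes P :: "nat \<Rightarrow> real poly" and c :: "nat \<Rightarrow> real"
  assumes rec: "recurrence_coeffs P c"
begin

definition a :: "nat \<Rightarrow> real" where "a n = 1 - c n"

lemma c_0 [simp]: "c 0 = 0" and c_pos: "0 < c (Suc n)" and c_less_1: "c n < 1" and P_0 [simp]: "P 0 = 1"
  using rec by (cases n; auto simp: recurrence_coeffs_def)+

lemma a_0 [simp]: "a 0 = 1" and a_pos: "0 < a n" and a_plus_c: "a n + c n = 1"
  using c_less_1 by (simp_all add: a_def)

lemma X_P: "pX * P n = smult (a n) (P (Suc n)) + smult (c n) (P (n - 1))"
  using rec by (simp only: recurrence_coeffs_def a_def Suc_eq_plus1 pX_def)

lemma P_1 [simp]: "P (Suc 0) = pX"
  using X_P[of 0] by simp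

text \<open>The reciprocal of the square norm of \<open>P n\<close> for the functional introduced below.\<close>

primrec h :: "nat \<Rightarrow> real" where
  "h 0 = 1"
| "h (Suc n) = a n / c (Suc n) * h n"

lemma h_pos: "0 < h n"
  by (induction n) (use a_pos c_pos in auto)

lemma c_h_Suc: "c (Suc n) * h (Suc n) = a n * h n"
  using c_pos[of n] by simp

lemma P_Suc: "P (Suc n) = smult (1 / a n) (pX * P n - smult (c n) (P (n - 1)))"
  using a_pos[of n] by (subst X_P) simp

lemma degree_P: "degree (P n) = n"
proof (induction n rule: less_induct)
  case (less n)
  show ?case
  proof (cases n)
    case (Suc m)
    have "degree (P m) = m" and "degree (P (m - 1)) = m - 1" using less Suc by auto
    have "P m \<noteq> 0"
      using \<open>degree (P m) = m\<close> by (cases m) auto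
    then have "degree (pX * P m) = Suc m"
      using \<open>degree (P m) = m\<close> by (subst degree_mult_eq) (auto simp: pX_def)
    moreover have "degree (smult (c m) (P (m - 1))) < Suc m"
      using \<open>degree (P (m - 1)) = m - 1\<close> degree_smult_le[of "c m" "P (m - 1)"] by linarith
    ultimately have "degree (pX * P m - smult (c m) (P (m - 1))) = Suc m"
      using degree_add_eq_left[of "- smult (c m) (P (m - 1))" "pX * P m"] by simp
    then show ?thesis using a_pos[of m] by (subst Suc, subst P_Suc) (simp add: Suc)
  qed simp
qed

lemma P_nonzero: "P n \<noteq> 0"
  using degree_P[of n] by (cases n) auto

lemma poly_P_1: "poly (P n) 1 = 1"
proof (induction n rule: less_induct)
  case (less n)
  show ?case
  proof (cases n)
    case (Suc m)
    have "poly (P m) 1 = 1" "poly (P (m - 1)) 1 = 1" using less Suc by auto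
    then show ?thesis
      using a_pos[of m] by (subst Suc, subst P_Suc) (simp add: a_def)
  qed simp
qed

lemma P_induct [case_names add smult basis]:
  assumes "\<And>p q. Pr p \<Longrightarrow> Pr q \<Longrightarrow> Pr (p + q)" "\<And>r p. Pr p \<Longrightarrow> Pr (smult r p)" "\<And>n. Pr (P n)"
  shows "Pr p"
  using degree_P P_nonzero assms by (rule graded_basis_induct)

end

locale rw_functional = rw_recurrence P c for P c +
  fixes L :: "real poly \<Rightarrow> real"
  assumes L_add: "L (p + q) = L p + L q"
    and L_smult: "L (smult r p) = r * L p"
    and L_one: "L 1 = 1"
    and L_P: "L (P (Suc n)) = 0"
begin

lemma L_0 [simp]: "L 0 = 0" using L_smult[of 0 0] by simp
lemma L_minus: "L (- p) = - L p" using L_smult[of "-1" p] by simp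
lemma L_diff: "L (p - q) = L p - L q" using L_add[of p "- q"] by (simp add: L_minus)
text \<open>Favard's theorem: moving a factor \<open>x\<close> from one polynomial to the other lets the recurrence
  propagate \<open>L (P n) = 0\<close> to orthogonality of the whole sequence.\<close>

lemma L_P_P: "L (P m * P n) = (if m = n then 1 / h n else 0)"
proof (induction m arbitrary: n rule: less_induct)
  case (less m)
  show ?case
  proof (cases m)
    case 0
    then show ?thesis using L_P[of "n - 1"] by (cases n) (auto simp: L_one)
  next
    case (Suc l)
    have IH: "L (P i * P j) = (if i = j then 1 / h j else 0)" if "i \<le> l" for i j
      using less[of i j] that Suc by simp
    have "a l * L (P m * P n) = L ((pX * P l) * P n) - c l * L (P (l - 1) * P n)"
      unfolding X_P by (simp add: Suc distrib_right L_add L_smult)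
    also have "(pX * P l) * P n = P l * (pX * P n)" by (simp only: mult_ac)
    also have "L \<dots> = a n * L (P l * P (Suc n)) + c n * L (P l * P (n - 1))"
      unfolding X_P by (simp add: distrib_left L_add L_smult)
    finally have "a l * L (P m * P n)
        = a n * L (P l * P (Suc n)) + c n * L (P l * P (n - 1)) - c l * L (P (l - 1) * P n)" .
    also have "\<dots> = (if m = n then a l / h n else 0)"
    proof -
      consider "n = Suc l" | "l = Suc n" | "n \<noteq> Suc l" "l \<noteq> Suc n" by blast
      then show ?thesis
      proof cases
        case 1
        have "c n / h l = a l / h n"
          using c_h_Suc[of l] h_pos[of l] h_pos[of n] 1 by (simp add: field_simps del: h.simps)
        then show ?thesis using 1 Suc by (simp add: IH)
      next
        case 2
        have "a n / h l = c l / h n"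
          using c_h_Suc[of n] h_pos[of l] h_pos[of n] 2 by (simp add: field_simps del: h.simps)
        then show ?thesis using 2 Suc by (simp add: IH)
      next
        case 3
        have "c n = 0 \<or> l \<noteq> n - 1" using 3 by (cases n) auto
        moreover have "c l = 0 \<or> l - 1 \<noteq> n" using 3 by (cases l) auto
        ultimately show ?thesis using 3 Suc by (auto simp: IH)
      qed
    qed
    finally have "a l * L (P m * P n) = a l * (if m = n then 1 / h n else 0)" by auto
    then show ?thesis using a_pos[of l] by simp
  qed
qed

text \<open>A polynomial is determined by its Fourier coefficients, being the sum of its finite Fourier
  series.\<close>

lemma eq_0_if_orthogonal:
  assumes "\<And>j. L (p * P j) = 0"
  shows "p = 0"
proof -
  have "\<exists>N0. \<forall>N\<ge>N0. p = (\<Sum>j\<le>N. smult (h j * L (p * P j)) (P j))"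
  proof (induction p rule: P_induct)
    case (add p q)
    then obtain M N where M: "\<And>n. n \<ge> M \<Longrightarrow> p = (\<Sum>j\<le>n. smult (h j * L (p * P j)) (P j))"
      and N: "\<And>n. n \<ge> N \<Longrightarrow> q = (\<Sum>j\<le>n. smult (h j * L (q * P j)) (P j))" by blast
    have "p + q = (\<Sum>j\<le>n. smult (h j * L ((p + q) * P j)) (P j))" if "n \<ge> max M N" for n
    proof -
      have "(\<Sum>j\<le>n. smult (h j * L ((p + q) * P j)) (P j))
          = (\<Sum>j\<le>n. smult (h j * L (p * P j)) (P j)) + (\<Sum>j\<le>n. smult (h j * L (q * P j)) (P j))"
        by (simp add: distrib_right distrib_left L_add smult_add_left sum.distrib)
      also have "\<dots> = p + q" using M[of n] N[of n] that by simp
      finally show ?thesis by (rule sym)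
    qed
    then show ?case by blast
  next
    case (smult r p)
    then obtain N where N: "\<forall>n\<ge>N. p = (\<Sum>j\<le>n. smult (h j * L (p * P j)) (P j))" by blast
    have "smult r p = (\<Sum>j\<le>n. smult (h j * L (smult r p * P j)) (P j))" if "n \<ge> N" for n
    proof -
      have "smult r p = [:r:] * (\<Sum>j\<le>n. smult (h j * L (p * P j)) (P j))"
        using N that by simp
      also have "\<dots> = (\<Sum>j\<le>n. smult (h j * L (smult r p * P j)) (P j))"
        by (subst sum_distrib_left) (simp add: L_smult mult_ac)
      finally show ?thesis .
    qed
    then show ?case by blast
  next
    case (basis n)
    have "P n = (\<Sum>j\<le>N. smult (h j * L (P n * P j)) (P j))" if "N \<ge> n" for N
    proof -
      have "(\<Sum>j\<le>N. smult (h j * L (P n * P j)) (P j)) = (\<Sum>j\<le>N. if j = n then P n else 0)"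
        using h_pos[of n] by (intro sum.cong) (auto simp: L_P_P)
      then show ?thesis using that by simp
    qed
    then show ?case by blast
  qed
  then show ?thesis using assms by auto
qed

definition b :: "nat \<Rightarrow> real" where "b n = a n * c (Suc n) + c n * a (n - 1)"

lemma one_minus_b: "1 - b n = a n * a (Suc n) + c n * c (n - 1)"
  unfolding b_def a_def by (simp add: algebra_simps)

lemma X_X_P: "pX * (pX * P n) = smult (a n * a (Suc n)) (P (Suc (Suc n))) + smult (b n) (P n)
     + smult (c n * c (n - 1)) (P (n - 2))"
proof (cases n)
  case 0
  show ?thesis unfolding X_P[of n] distrib_left mult_smult_right X_P[of "Suc n"]
    by (simp add: 0 b_def smult_add_right smult_add_left)
next
  case (Suc m)
  show ?thesis unfolding X_P[of n] distrib_left mult_smult_right X_P[of "Suc n"] X_P[of "n - 1"]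
    by (simp add: Suc b_def smult_add_right smult_add_left numeral_2_eq_2)
qed

subsection \<open>The polynomials orthogonal with respect to the weight multiplied by \<open>1 - x\<^sup>2\<close>\<close>

text \<open>The Christoffel kernel at \<open>1\<close>, that is the sum of \<open>h j * P j 1 * P j\<close>, restricted to the \<open>j\<close> of one
  parity.\<close>

fun S :: "nat \<Rightarrow> real poly" where
  "S 0 = 1"
| "S (Suc 0) = smult (h 1) (P 1)"
| "S (Suc (Suc n)) = S n + smult (h (Suc (Suc n))) (P (Suc (Suc n)))"

lemma L_S_P: "L (S n * P j) = (if j \<le> n \<and> even (n + j) then 1 else 0)"
proof (induction n rule: S.induct)
  case 1
  show ?case using L_P_P[of 0 j] by (cases j) auto
next
  case 2
  show ?case using L_P_P[of 1 j] h_pos[of 1] by (auto simp: L_smult dest!: le_SucE simp del: P_1 h.simps)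
next
  case (3 n)
  show ?case using h_pos[of j]
    by (auto simp: distrib_right L_add L_smult 3 L_P_P simp del: h.simps elim!: le_SucE)
qed

lemma poly_S_1: "poly (S n) 1 > 0"
  by (induction n rule: S.induct)
     (use h_pos poly_P_1 in \<open>auto intro!: add_pos_pos simp del: h.simps P_1\<close>)

lemma degree_S: "degree (S n) = n"
proof (induction n rule: S.induct)
  case 2
  show ?case using h_pos[of 1] degree_P[of 1] by (simp del: h.simps P_1)
next
  case (3 n)
  show ?case using h_pos[of "Suc (Suc n)"] degree_P[of "Suc (Suc n)"] 3
    by (simp add: degree_add_eq_right del: h.simps)
qed simp

text \<open>Christoffel--Darboux: multiplied by \<open>1 - x\<^sup>2\<close>, the partial sums telescope.\<close>

lemma weight_S: "[:1, 0, -1:] * S n = smult (h n * a n * a (Suc n)) (P n - P (Suc (Suc n)))"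
proof -
  have step: "smult (h n) (P n - pX * (pX * P n)) = smult (h n * a n * a (Suc n)) (P n - P (Suc (Suc n)))
      + smult (h n * c n * c (n - 1)) (P n - P (n - 2))" for n
  proof -
    have "P n - pX * (pX * P n) = smult (1 - b n) (P n) - smult (a n * a (Suc n)) (P (Suc (Suc n)))
        - smult (c n * c (n - 1)) (P (n - 2))"
      unfolding X_X_P by (simp add: smult_diff_left)
    then show ?thesis unfolding one_minus_b
      by (simp add: smult_diff_right smult_add_right smult_add_left mult_ac)
  qed
  show ?thesis
  proof (induction n rule: S.induct)
    case 1
    show ?case using step[of 0] by (simp only: one_minus_sq_times S.simps) simp
  next
    case 2
    show ?case using step[of 1] by (simp only: one_minus_sq_times S.simps mult_smult_right smult_diff_right) (simp add: smult_diff_right)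
  next
    case (3 n)
    have "h n * a n * a (Suc n) = h (Suc (Suc n)) * c (Suc (Suc n)) * c (Suc n)"
      using c_h_Suc[of n] c_h_Suc[of "Suc n"] by (simp add: mult_ac del: h.simps)
    with 3 step[of "Suc (Suc n)"] show ?case
      unfolding one_minus_sq_times S.simps distrib_left mult_smult_right
      by (simp add: smult_diff_right algebra_simps del: h.simps)
  qed
qed

lemma L_weight_S_P: "j < n \<Longrightarrow> L ([:1, 0, -1:] * S n * P j) = 0"
  by (simp only: weight_S) (simp add: L_smult L_P_P left_diff_distrib L_diff)

lemma L_weight_S_S: "L ([:1, 0, -1:] * S n * S m) = (if m = n then h n * a n * a (Suc n) else 0)"
proof -
  have *: "L ([:1, 0, -1:] * S n * S m) = (if m = n then h n * a n * a (Suc n) else 0)" if "m \<le> n" for m n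
  proof -
    have "L ([:1, 0, -1:] * S n * S m) = h n * a n * a (Suc n) * (L (S m * P n) - L (S m * P (Suc (Suc n))))"
      by (simp only: weight_S) (simp add: L_smult left_diff_distrib L_diff mult.commute[of "S m"])
    also have "\<dots> = (if m = n then h n * a n * a (Suc n) else 0)"
      using that by (simp add: L_S_P)
    finally show ?thesis .
  qed
  show ?thesis
  proof (cases "m \<le> n")
    case False
    then have "L ([:1, 0, -1:] * S m * S n) = 0" using *[of n m] by simp
    moreover have "[:1, 0, -1:] * S m * S n = [:1, 0, -1:] * S n * S m" by (simp only: mult_ac)
    ultimately show ?thesis using False by simp
  qed (rule *)
qed

end

section \<open>Polynomial identities\<close>

text \<open>The following three eliminations enter the proof that the coefficients are flat.  In each of them
  the difference of the two sides is an explicit combination of the hypotheses; it arises by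
  eliminating the products \<open>c i * x i\<close> first and then the highest of the remaining \<open>g i\<close>.\<close>

lemma second_order_identity:
  fixes A c0 c1 c2 g0 g1 g2 g3 x0 x1 x2 :: real
  assumes "c0 * x0 = g0" "c1 * x1 = g1" "c2 * x2 = g2"
    and "g2 - g0 + x0 = A * x1" "g3 - g1 + x1 = A * x2" "x1 = A * x0 + 2 * g1 - 2 * A * g0"
  shows "2 * A * c1 * (g2 + (1 - c0) * g0)
    + ((1 - c0) * (1 - c1) - A\<^sup>2 - ((1 - c1) * c2 + c1 * (1 - c0))) * g1 - c1 * c2 * g3 = 0" (is "?l = 0")
proof -
  have "?l = c1 * (A * (g2 - g0 + x0 - A * x1) + (1 - c0) * (x1 - (A * x0 + 2 * g1 - 2 * A * g0))
      - A * (c0 * x0 - g0) - A * (c2 * x2 - g2) - c2 * (g3 - g1 + x1 - A * x2)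
      - (2 * (1 - c0) - c2) * (c1 * x1 - g1))
    - ((1 - c0) * (1 - c1) - A\<^sup>2 - (1 - c1) * c2 - c1 * (1 - c0)) * (c1 * x1 - g1)"
    by (simp add: algebra_simps power2_eq_square)
  then show ?thesis using assms by simp
qed

lemma second_order_identity_start:
  fixes A c1 c2 g1 g2 g3 x1 x2 :: real
  assumes "c1 * x1 = 1" "c2 * x2 = 2 * A"
    and "g3 - 1 + x1 = A * x2" "(1 - A\<^sup>2) * x1 = 2 * (1 - A\<^sup>2)"
  shows "2 * A * c1 * (2 * A) + (1 - c1 - A\<^sup>2 - ((1 - c1) * c2 + c1)) - c1 * c2 * g3 = 0" (is "?l = 0")
proof -
  have "?l = c1 * ((1 - A\<^sup>2) * x1 - 2 * (1 - A\<^sup>2) - c2 * (g3 - 1 + x1 - A * x2) - A * (c2 * x2 - 2 * A))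
     - (1 - A\<^sup>2 - c2) * (c1 * x1 - 1)"
    by (simp add: algebra_simps power2_eq_square)
  then show ?thesis using assms by simp
qed

lemma lower_order_identity:
  fixes A c0 c1 c2 c3 g0 g1 g2 g3 g4 x0 x1 x2 x3 :: real
  assumes "c0 * x0 = g0" "c1 * x1 = g1" "c2 * x2 = g2" "c3 * x3 = g3"
    and "g2 - g0 + x0 = A * x1" "g3 - g1 + x1 = A * x2" "g4 - g2 + x2 = A * x3"
  shows "2 * A * (g3 + (1 - c1) * x1) - ((1 - c2) * c3 + c2 * (1 - c1) + A\<^sup>2) * x2
    - (1 - c1) * (1 - c0) * x0 = c3 * g4"
proof -
  have "2 * A * (g3 + (1 - c1) * x1) - ((1 - c2) * c3 + c2 * (1 - c1) + A\<^sup>2) * x2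
    - (1 - c1) * (1 - c0) * x0 - c3 * g4
    = A * (g3 - g1 + x1 - A * x2) - A * (c1 * x1 - g1) - A * (c3 * x3 - g3) - c3 * (g4 - g2 + x2 - A * x3)
      + (c3 - (1 - c1)) * (c2 * x2 - g2) - (1 - c1) * (g2 - g0 + x0 - A * x1) + (1 - c1) * (c0 * x0 - g0)"
    by (simp add: algebra_simps power2_eq_square)
  then show ?thesis using assms by simp
qed

section \<open>Fourier coefficients of the images of the operator\<close>

locale rw_askey = rw_functional P c L + chebyshev_parameter k
  for P c L k
begin

definition \<kappa> :: "nat \<Rightarrow> nat \<Rightarrow> real" where "\<kappa> n j = L (D (P n) * P j)"

text \<open>The ratio of the leading coefficients of \<open>D (P n)\<close> and \<open>P (n - 1)\<close> is \<open>\<gamma> n / a (n - 1)\<close>, whence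
  \<open>\<kappa> n (n - 1)\<close> has this value.\<close>

definition \<sigma> :: "nat \<Rightarrow> real" where "\<sigma> n = \<gamma> n / (c n * h n)"

lemma \<sigma>_0 [simp]: "\<sigma> 0 = 0" by (simp add: \<sigma>_def)

lemma c_h_\<sigma>: "c n * h n * \<sigma> n = \<gamma> n"
  using c_pos[of "n - 1"] h_pos[of n] by (cases n) (simp_all add: \<sigma>_def del: h.simps)

lemma a_h_\<sigma>: "a n * h n * \<sigma> (Suc n) = \<gamma> (Suc n)"
  using c_h_\<sigma>[of "Suc n"] c_h_Suc[of n] by (simp del: h.simps)

text \<open>The commutation relation applied to \<open>P n\<close> and tested against \<open>P j\<close>; multiplication by \<open>x\<close> is
  self-adjoint.  Truncated indices such as \<open>n - 2\<close> are harmless, as their factor \<open>c n * c (n - 1)\<close> is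
  zero for \<open>n \<le> 1\<close>.\<close>

lemma \<kappa>_rec:
  "a n * a (Suc n) * \<kappa> (Suc (Suc n)) j + b n * \<kappa> n j + c n * c (n - 1) * \<kappa> (n - 2) j
   + (a j * a (Suc j) * \<kappa> n (Suc (Suc j)) + b j * \<kappa> n j + c j * c (j - 1) * \<kappa> n (j - 2))
   = 2 * \<alpha> * (a n * (a j * \<kappa> (Suc n) (Suc j) + c j * \<kappa> (Suc n) (j - 1))
              + c n * (a j * \<kappa> (n - 1) (Suc j) + c j * \<kappa> (n - 1) (j - 1)))
     + (1 - \<alpha>\<^sup>2) * \<kappa> n j"
proof -
  have "L ((D (pX * (pX * P n)) + pX * (pX * D (P n))) * P j)
      = L ((smult (2 * \<alpha>) (pX * D (pX * P n)) + smult (1 - \<alpha>\<^sup>2) (D (P n))) * P j)"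
    by (simp only: D_commutation)
  moreover have "(D (pX * (pX * P n)) + pX * (pX * D (P n))) * P j
      = D (pX * (pX * P n)) * P j + D (P n) * (pX * (pX * P j))"
    by (simp add: algebra_simps)
  moreover have "(smult (2 * \<alpha>) (pX * D (pX * P n)) + smult (1 - \<alpha>\<^sup>2) (D (P n))) * P j
      = smult (2 * \<alpha>) (D (pX * P n) * (pX * P j)) + smult (1 - \<alpha>\<^sup>2) (D (P n) * P j)"
    by (simp add: algebra_simps)
  ultimately have "L (D (pX * (pX * P n)) * P j) + L (D (P n) * (pX * (pX * P j)))
      = 2 * \<alpha> * L (D (pX * P n) * (pX * P j)) + (1 - \<alpha>\<^sup>2) * L (D (P n) * P j)"
    by (simp only: L_add L_smult)
  then show ?thesis
    unfolding X_X_P[of n] X_X_P[of j] unfolding X_P[of n] X_P[of j]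
    by (simp add: D_add D_smult L_add L_smult distrib_left distrib_right \<kappa>_def algebra_simps)
qed

lemma \<kappa>_0: "\<kappa> 0 j = 0" by (simp add: \<kappa>_def)

lemma \<kappa>_1: "\<kappa> (Suc 0) j = (if j = 0 then 1 else 0)"
  using L_P_P[of 0 j] by (simp add: \<kappa>_def)

lemma \<kappa>_rec_solved:
  "a n * a (Suc n) * \<kappa> (Suc (Suc n)) j
   = 2 * \<alpha> * (a n * (a j * \<kappa> (Suc n) (Suc j) + c j * \<kappa> (Suc n) (j - 1))
              + c n * (a j * \<kappa> (n - 1) (Suc j) + c j * \<kappa> (n - 1) (j - 1)))
     + (1 - \<alpha>\<^sup>2) * \<kappa> n j
     - (b n * \<kappa> n j + c n * c (n - 1) * \<kappa> (n - 2) j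
   + (a j * a (Suc j) * \<kappa> n (Suc (Suc j)) + b j * \<kappa> n j + c j * c (j - 1) * \<kappa> n (j - 2)))"
  using \<kappa>_rec[of n j] by linarith

text \<open>\<open>D\<close> lowers degrees and reverses parity; on the level of \<open>\<kappa>\<close> both facts spread from the first two
  rows by the recurrence.\<close>

lemma \<kappa>_eq_0: "j \<ge> n \<or> even (n + j) \<Longrightarrow> \<kappa> n j = 0"
proof (induction n arbitrary: j rule: less_induct)
  case (less n)
  consider "n = 0" | "n = Suc 0" | m where "n = Suc (Suc m)" by (metis not0_implies_Suc)
  then show ?case
  proof cases
    case 1
    then show ?thesis by (simp add: \<kappa>_0)
  next
    case 2
    then show ?thesis using less.prems by (auto simp: \<kappa>_1 intro: odd_pos)
  next
    case 3
    have 1: "\<kappa> m i = 0" if "i \<ge> m \<or> even (m + i)" for i using less.IH[of m i] that 3 by simp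
    have 2: "\<kappa> (Suc m) i = 0" if "i \<ge> Suc m \<or> even (Suc m + i)" for i
      using less.IH[of "Suc m" i] that 3 by simp
    have 4: "\<kappa> (m - 1) i = 0" if "i \<ge> m - 1 \<or> even (m - 1 + i)" for i
      using less.IH[of "m - 1" i] that 3 by simp
    have 5: "\<kappa> (m - 2) i = 0" if "i \<ge> m - 2 \<or> even (m - 2 + i)" for i
      using less.IH[of "m - 2" i] that 3 by simp
    have j: "j \<ge> Suc (Suc m) \<or> even (m + j)" using less.prems 3 by auto
    have z1: "\<kappa> m j = 0" "\<kappa> m (Suc (Suc j)) = 0" "\<kappa> (Suc m) (Suc j) = 0"
      using j by (auto intro!: 1 2)
    have z2: "c j * c (j - 1) * \<kappa> m (j - 2) = 0"
    proof (cases "j \<le> 1")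
      case False
      then have "\<kappa> m (j - 2) = 0" using j by (intro 1) auto
      then show ?thesis by simp
    qed (auto simp: le_Suc_eq)
    have z3: "c j * \<kappa> (Suc m) (j - 1) = 0"
      using 2[of "j - 1"] j by (cases j) auto
    have z4: "c m * (a j * \<kappa> (m - 1) (Suc j) + c j * \<kappa> (m - 1) (j - 1)) = 0"
      using 4[of "Suc j"] 4[of "j - 1"] j by (cases m; cases j) auto
    have z5: "c m * c (m - 1) * \<kappa> (m - 2) j = 0"
    proof (cases "m \<le> 1")
      case False
      then have "\<kappa> (m - 2) j = 0" using j by (intro 5) auto
      then show ?thesis by simp
    qed (auto simp: le_Suc_eq)
    have "a m * a (Suc m) * \<kappa> (Suc (Suc m)) j = 0"
      unfolding \<kappa>_rec_solved z1 z2 z3 z4 z5 by simp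
    then show ?thesis using a_pos[of m] a_pos[of "Suc m"] 3 by simp
  qed
qed

lemma \<kappa>_Suc: "\<kappa> (Suc n) n = \<sigma> (Suc n)"
proof (induction n rule: less_induct)
  case (less n)
  show ?case
  proof (cases n)
    case 0
    then show ?thesis using a_h_\<sigma>[of 0] by (simp add: \<kappa>_1)
  next
    case (Suc m)
    have IH: "\<kappa> (Suc m) m = \<sigma> (Suc m)" using less Suc by simp
    have IH2: "c m * \<kappa> m (m - 1) = c m * \<sigma> m"
      using less[of "m - 1"] Suc by (cases m) auto
    have "\<kappa> (m - 1) (Suc (Suc m)) = 0" and "\<kappa> (m - 2) (Suc m) = 0"
      by (auto intro: \<kappa>_eq_0)
    then have "a m * a (Suc m) * \<kappa> (Suc (Suc m)) (Suc m)
        = 2 * \<alpha> * (a m * c (Suc m) * \<kappa> (Suc m) m) - c (Suc m) * (c m * \<kappa> m (m - 1))"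
      unfolding \<kappa>_rec_solved[of m "Suc m"] by (simp add: \<kappa>_eq_0)
    also have "\<dots> = a m * (2 * \<alpha> * (c (Suc m) * \<sigma> (Suc m))) - c (Suc m) * c m * \<sigma> m"
      unfolding IH IH2 by simp
    finally have "h (Suc m) * (a m * a (Suc m) * \<kappa> (Suc (Suc m)) (Suc m))
        = h (Suc m) * (a m * (2 * \<alpha> * (c (Suc m) * \<sigma> (Suc m))) - c (Suc m) * c m * \<sigma> m)"
      by (rule arg_cong)
    also have "\<dots> = a m * (2 * \<alpha> * (c (Suc m) * h (Suc m) * \<sigma> (Suc m))) - (c (Suc m) * h (Suc m)) * c m * \<sigma> m"
      by (simp add: algebra_simps del: h.simps)
    also have "(c (Suc m) * h (Suc m)) * c m * \<sigma> m = a m * (c m * h m * \<sigma> m)"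
      unfolding c_h_Suc by simp
    also have "a m * (2 * \<alpha> * (c (Suc m) * h (Suc m) * \<sigma> (Suc m))) - a m * (c m * h m * \<sigma> m)
        = a m * \<gamma> (Suc (Suc m))"
      unfolding c_h_\<sigma> by (simp add: \<gamma>_rec algebra_simps)
    also have "\<dots> = h (Suc m) * (a m * a (Suc m) * \<sigma> (Suc (Suc m)))"
      unfolding a_h_\<sigma>[of "Suc m", symmetric] by (simp add: mult_ac del: h.simps)
    finally show ?thesis
      using h_pos[of "Suc m"] a_pos[of m] a_pos[of "Suc m"] Suc by (simp del: h.simps)
  qed
qed

text \<open>As the coefficients \<open>L (S (n - 1) * P j)\<close> are constant on one parity class below \<open>n\<close>, this expresses that
  \<open>D (P n)\<close> is a multiple of \<open>S (n - 1)\<close>.\<close>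

definition flat_at :: "nat \<Rightarrow> bool" where
  "flat_at n \<longleftrightarrow> (\<forall>j<n. odd (n + j) \<longrightarrow> \<kappa> n j = \<sigma> n)"

lemma D_P_eq:
  assumes "flat_at (Suc n)"
  shows "D (P (Suc n)) = smult (\<sigma> (Suc n)) (S n)"
proof -
  have "L ((D (P (Suc n)) - smult (\<sigma> (Suc n)) (S n)) * P j) = 0" for j
  proof -
    have "\<kappa> (Suc n) j = (if j \<le> n \<and> even (n + j) then \<sigma> (Suc n) else 0)"
      using assms \<kappa>_eq_0[of "Suc n" j] by (auto simp: flat_at_def)
    then show ?thesis by (simp add: left_diff_distrib L_diff L_smult L_S_P \<kappa>_def)
  qed
  then have "D (P (Suc n)) - smult (\<sigma> (Suc n)) (S n) = 0" by (rule eq_0_if_orthogonal)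
  then show ?thesis by simp
qed

text \<open>On the coefficients of one parity, multiplication by \<open>1 - x\<^sup>2\<close> is a weighted second difference,
  because \<open>1 - b j = a j * a (j + 1) + c j * c (j - 1)\<close>.  At the lower end \<open>c 0 = 0\<close> removes one of the two
  differences, so that all of them vanish successively.\<close>

lemma flat_if_orthogonal:
  assumes orth: "\<And>n j. j \<le> n \<Longrightarrow> L ([:1, 0, -1:] * D (P (Suc (Suc n))) * P j) = 0"
  shows "flat_at n"
proof -
  have step: "\<kappa> (Suc (Suc n)) (Suc (Suc j)) = \<kappa> (Suc (Suc n)) j" if "j \<le> n" for n j
    using that
  proof (induction j rule: less_induct)
    case (less j)
    let ?k = "\<kappa> (Suc (Suc n))"
    have "[:1, 0, -1:] * D (P (Suc (Suc n))) * P j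
        = D (P (Suc (Suc n))) * P j - D (P (Suc (Suc n))) * (pX * (pX * P j))"
      unfolding one_minus_sq_times by (simp add: algebra_simps)
    then have "0 = L (D (P (Suc (Suc n))) * P j) - L (D (P (Suc (Suc n))) * (pX * (pX * P j)))"
      using orth[OF less.prems] by (simp add: L_diff)
    also have "\<dots> = (1 - b j) * ?k j - a j * a (Suc j) * ?k (Suc (Suc j)) - c j * c (j - 1) * ?k (j - 2)"
      unfolding X_X_P by (simp add: distrib_left L_add L_smult \<kappa>_def algebra_simps)
    finally have "a j * a (Suc j) * (?k (Suc (Suc j)) - ?k j) = c j * c (j - 1) * (?k j - ?k (j - 2))"
      unfolding one_minus_b by (simp add: algebra_simps)
    moreover have "c j * c (j - 1) * (?k j - ?k (j - 2)) = 0"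
    proof (cases "j \<le> 1")
      case False
      then have "Suc (Suc (j - 2)) = j" by simp
      then show ?thesis using less.IH[of "j - 2"] less.prems False by simp
    qed (auto simp: le_Suc_eq)
    ultimately have "a j * a (Suc j) * (?k (Suc (Suc j)) - ?k j) = 0" by (rule trans)
    then show ?case using a_pos[of j] a_pos[of "Suc j"] by simp
  qed
  have *: "\<kappa> (Suc (j + 2 * i)) j = \<sigma> (Suc (j + 2 * i))" for i j
  proof (induction i arbitrary: j)
    case 0
    show ?case by (simp add: \<kappa>_Suc)
  next
    case (Suc i)
    have eq: "j + 2 * Suc i = Suc (Suc (j + 2 * i))" by simp
    have "\<kappa> (Suc (Suc (Suc (j + 2 * i)))) (Suc (Suc j)) = \<kappa> (Suc (Suc (Suc (j + 2 * i)))) j"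
      by (rule step) simp
    then show ?case unfolding eq using Suc.IH[of "Suc (Suc j)"] by simp
  qed
  show ?thesis unfolding flat_at_def
  proof (intro allI impI)
    fix j assume j: "j < n" "odd (n + j)"
    then have "\<exists>i. n = Suc (j + 2 * i)" by presburger
    then obtain i where "n = Suc (j + 2 * i)" ..
    then show "\<kappa> n j = \<sigma> n" by (simp only: *)
  qed
qed

lemma orthogonal_if_multiple:
  assumes "D (P (Suc n)) = smult r (S n)" "j < n"
  shows "L ([:1, 0, -1:] * D (P (Suc n)) * P j) = 0"
  using L_weight_S_P[OF assms(2)] unfolding assms(1) mult_smult_left mult_smult_right by (simp only: L_smult)

section \<open>Flatness and the recurrence coefficients\<close>

text \<open>For \<open>n \<ge> 1\<close> this is \<open>\<gamma> n / c n\<close>, free of the square norms.\<close>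

definition x :: "nat \<Rightarrow> real" where "x n = h n * \<sigma> n"

lemma c_x: "c n * x n = \<gamma> n"
  using c_h_\<sigma>[of n] by (simp add: x_def mult_ac)

text \<open>The defect of flatness of the second coefficient of a row, given flatness of the second coefficients
  of the two rows before.\<close>

lemma second_coefficient:
  assumes "m > 0 \<Longrightarrow> \<kappa> (Suc (Suc m)) (m - 1) = \<sigma> (Suc (Suc m))"
    and "m > 1 \<Longrightarrow> \<kappa> (Suc m) (m - 2) = \<sigma> (Suc m)"
  shows "a (Suc m) * a (Suc (Suc m)) * c (Suc m) * h (Suc m)
           * (\<kappa> (Suc (Suc (Suc m))) m - \<sigma> (Suc (Suc (Suc m))))
         = 2 * \<alpha> * c (Suc m) * (\<gamma> (Suc (Suc m)) + a m * \<gamma> m)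
           + (a m * a (Suc m) - \<alpha>\<^sup>2 - b (Suc m)) * \<gamma> (Suc m)
           - c (Suc m) * c (Suc (Suc m)) * \<gamma> (Suc (Suc (Suc m)))"
proof -
  let ?y = "\<kappa> (Suc (Suc (Suc m))) m"
  have 1: "c m * \<kappa> (Suc (Suc m)) (m - 1) = c m * \<sigma> (Suc (Suc m))"
    using assms(1) by (cases m) auto
  have 2: "c m * c (m - 1) * \<kappa> (Suc m) (m - 2) = c m * c (m - 1) * \<sigma> (Suc m)"
    using assms(2) by (cases "m \<le> 1") (auto simp: le_Suc_eq)
  have 3: "c m * \<kappa> m (m - 1) = c m * \<sigma> m"
    using \<kappa>_Suc[of "m - 1"] by (cases m) auto
  have 4: "\<kappa> (m - 1) m = 0" "\<kappa> (Suc m) (Suc (Suc m)) = 0" "\<kappa> m (Suc m) = 0"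
    by (auto intro: \<kappa>_eq_0)
  have "a (Suc m) * a (Suc (Suc m)) * ?y
      = 2 * \<alpha> * (a (Suc m) * (a m * \<sigma> (Suc (Suc m)) + c m * \<kappa> (Suc (Suc m)) (m - 1)) + c (Suc m) * (c m * \<kappa> m (m - 1)))
        + (1 - \<alpha>\<^sup>2 - b (Suc m) - b m) * \<sigma> (Suc m) - c m * c (m - 1) * \<kappa> (Suc m) (m - 2)"
    using \<kappa>_rec_solved[of "Suc m" m] 4 by (simp add: \<kappa>_Suc algebra_simps)
  also have "\<dots> = 2 * \<alpha> * (a (Suc m) * ((a m + c m) * \<sigma> (Suc (Suc m))) + c (Suc m) * (c m * \<sigma> m))
        + ((1 - b m) - c m * c (m - 1) - \<alpha>\<^sup>2 - b (Suc m)) * \<sigma> (Suc m)"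
    unfolding 1 2 3 by (simp add: algebra_simps)
  also have "\<dots> = 2 * \<alpha> * (a (Suc m) * \<sigma> (Suc (Suc m)) + c (Suc m) * (c m * \<sigma> m))
        + (a m * a (Suc m) - \<alpha>\<^sup>2 - b (Suc m)) * \<sigma> (Suc m)"
    unfolding one_minus_b a_plus_c by simp
  finally have y: "a (Suc m) * a (Suc (Suc m)) * ?y
      = 2 * \<alpha> * (a (Suc m) * \<sigma> (Suc (Suc m)) + c (Suc m) * (c m * \<sigma> m))
        + (a m * a (Suc m) - \<alpha>\<^sup>2 - b (Suc m)) * \<sigma> (Suc m)" .
  have "a (Suc m) * a (Suc (Suc m)) * c (Suc m) * h (Suc m) * ?y
      = c (Suc m) * h (Suc m) * (a (Suc m) * a (Suc (Suc m)) * ?y)"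
    by (simp add: mult_ac del: h.simps)
  also have "\<dots> = c (Suc m) * h (Suc m) * (2 * \<alpha> * (a (Suc m) * \<sigma> (Suc (Suc m)) + c (Suc m) * (c m * \<sigma> m))
        + (a m * a (Suc m) - \<alpha>\<^sup>2 - b (Suc m)) * \<sigma> (Suc m))"
    unfolding y ..
  also have "\<dots> = 2 * \<alpha> * c (Suc m) * (a (Suc m) * h (Suc m) * \<sigma> (Suc (Suc m)) + (c (Suc m) * h (Suc m)) * (c m * \<sigma> m))
        + (a m * a (Suc m) - \<alpha>\<^sup>2 - b (Suc m)) * (c (Suc m) * h (Suc m) * \<sigma> (Suc m))"
    by (simp add: algebra_simps del: h.simps)
  also have "(c (Suc m) * h (Suc m)) * (c m * \<sigma> m) = a m * \<gamma> m"
    unfolding c_h_Suc by (simp add: c_h_\<sigma>[symmetric])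
  also have "a (Suc m) * a (Suc (Suc m)) * c (Suc m) * h (Suc m) * ?y
      = a (Suc m) * a (Suc (Suc m)) * c (Suc m) * h (Suc m) * (?y - \<sigma> (Suc (Suc (Suc m))))
        + c (Suc m) * c (Suc (Suc m)) * \<gamma> (Suc (Suc (Suc m)))"
  proof -
    have "c (Suc m) * c (Suc (Suc m)) * \<gamma> (Suc (Suc (Suc m)))
        = a (Suc m) * a (Suc (Suc m)) * c (Suc m) * h (Suc m) * \<sigma> (Suc (Suc (Suc m)))"
      using c_h_Suc[of "Suc m"] unfolding a_h_\<sigma>[symmetric] by (simp add: mult_ac del: h.simps)
    then show ?thesis by (simp only: right_diff_distrib diff_add_cancel)
  qed
  finally show ?thesis unfolding a_h_\<sigma> c_h_\<sigma> by linarith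
qed

text \<open>For \<open>j + 3 \<le> n\<close> the recurrence expresses \<open>\<kappa> (n + 2) j\<close> by entries of flat rows that lie strictly
  below the diagonal.  The coefficients depending on \<open>j\<close> then sum to one, so that \<open>j\<close> disappears.
  The neighbouring rows of the other parity enter with the factor \<open>\<alpha>\<close>; dropping them for \<open>\<alpha> = 0\<close>
  permits to use the lemma for \<open>k = 2\<close> when row \<open>n + 1\<close> is not yet known to be flat.\<close>

lemma lower_coefficient:
  assumes "j + 3 \<le> n" "odd (n + j)"
    and "\<alpha> \<noteq> 0 \<Longrightarrow> flat_at (Suc n)" "flat_at n" "\<alpha> \<noteq> 0 \<Longrightarrow> flat_at (n - 1)" "flat_at (n - 2)"
  shows "a n * a (Suc n) * h n * \<kappa> (Suc (Suc n)) j
      = 2 * \<alpha> * (\<gamma> (Suc n) + a (n - 1) * x (n - 1)) - (b n + \<alpha>\<^sup>2) * x n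
        - a (n - 1) * a (n - 2) * x (n - 2)"
proof -
  have 1: "\<alpha> * \<kappa> (Suc n) (Suc j) = \<alpha> * \<sigma> (Suc n)" "\<alpha> * \<kappa> (n - 1) (Suc j) = \<alpha> * \<sigma> (n - 1)"
    using assms by (cases "\<alpha> = 0"; auto simp: flat_at_def)+
  have 2: "c j * (\<alpha> * \<kappa> (Suc n) (j - 1)) = c j * (\<alpha> * \<sigma> (Suc n))"
      "c j * (\<alpha> * \<kappa> (n - 1) (j - 1)) = c j * (\<alpha> * \<sigma> (n - 1))"
    using assms by (cases "\<alpha> = 0"; cases j; auto simp: flat_at_def)+
  have 3: "\<kappa> n j = \<sigma> n" "\<kappa> n (Suc (Suc j)) = \<sigma> n" "\<kappa> (n - 2) j = \<sigma> (n - 2)"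
    using assms by (auto simp: flat_at_def)
  have 4: "c j * c (j - 1) * \<kappa> n (j - 2) = c j * c (j - 1) * \<sigma> n"
    using assms by (cases "j \<le> 1") (auto simp: le_Suc_eq flat_at_def)
  have "a n * a (Suc n) * \<kappa> (Suc (Suc n)) j
      = 2 * (a n * (a j * (\<alpha> * \<kappa> (Suc n) (Suc j)) + c j * (\<alpha> * \<kappa> (Suc n) (j - 1)))
           + c n * (a j * (\<alpha> * \<kappa> (n - 1) (Suc j)) + c j * (\<alpha> * \<kappa> (n - 1) (j - 1))))
        + (1 - \<alpha>\<^sup>2) * \<kappa> n j - (b n * \<kappa> n j + c n * c (n - 1) * \<kappa> (n - 2) j
        + (a j * a (Suc j) * \<kappa> n (Suc (Suc j)) + b j * \<kappa> n j + c j * c (j - 1) * \<kappa> n (j - 2)))"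
    unfolding \<kappa>_rec_solved by (simp add: algebra_simps)
  also have "\<dots> = 2 * \<alpha> * ((a j + c j) * (a n * \<sigma> (Suc n) + c n * \<sigma> (n - 1)))
        + ((1 - b j) - a j * a (Suc j) - c j * c (j - 1) - b n - \<alpha>\<^sup>2) * \<sigma> n - c n * c (n - 1) * \<sigma> (n - 2)"
    unfolding 1 2 3 4 by (simp add: algebra_simps)
  also have "\<dots> = 2 * \<alpha> * (a n * \<sigma> (Suc n) + c n * \<sigma> (n - 1)) - (b n + \<alpha>\<^sup>2) * \<sigma> n - c n * c (n - 1) * \<sigma> (n - 2)"
    unfolding one_minus_b a_plus_c by (simp add: algebra_simps)
  finally have "h n * (a n * a (Suc n) * \<kappa> (Suc (Suc n)) j) = h n * (2 * \<alpha> * (a n * \<sigma> (Suc n)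
      + c n * \<sigma> (n - 1)) - (b n + \<alpha>\<^sup>2) * \<sigma> n - c n * c (n - 1) * \<sigma> (n - 2))"
    by (rule arg_cong)
  then have *: "a n * a (Suc n) * h n * \<kappa> (Suc (Suc n)) j = 2 * \<alpha> * (a n * h n * \<sigma> (Suc n) + (c n * h n) * \<sigma> (n - 1))
      - (b n + \<alpha>\<^sup>2) * x n - c (n - 1) * (c n * h n) * \<sigma> (n - 2)"
    by (simp add: x_def algebra_simps)
  define l where "l = n - 2"
  have l: "n = Suc (Suc l)" using assms(1) by (simp add: l_def)
  have "c n * h n = a (Suc l) * h (Suc l)" unfolding l by (rule c_h_Suc)
  moreover have "c (Suc l) * h (Suc l) = a l * h l" by (rule c_h_Suc)
  ultimately show ?thesis unfolding * a_h_\<sigma> by (simp add: l x_def mult_ac del: h.simps)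
qed

text \<open>For \<open>n \<ge> 1\<close> this means that \<open>x n\<close> is \<open>2 * \<gamma> n + s * \<tau> n\<close>, a solution of the Chebyshev recurrence.
  It covers both families of the theorem: with \<open>k \<ge> 2\<close> and \<open>s = 0\<close>, \<open>c n\<close> is \<open>1 / 2\<close> unless \<open>\<gamma> n = 0\<close>;
  with \<open>k = 1\<close>, where \<open>\<gamma> n = n\<close> and \<open>\<tau> n = 1\<close>, it reads \<open>c n = n / (2 n + s)\<close>.\<close>

definition good_coeff :: "real \<Rightarrow> nat \<Rightarrow> bool" where
  "good_coeff s n \<longleftrightarrow> \<gamma> n = c n * (2 * \<gamma> n + s * \<tau> n)"

lemma x_good: "good_coeff s (Suc n) \<Longrightarrow> x (Suc n) = 2 * \<gamma> (Suc n) + s * \<tau> (Suc n)"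
  using c_x[of "Suc n"] c_pos[of n] unfolding good_coeff_def by (metis less_irrefl mult_left_cancel)

text \<open>The first coefficient of a row is always \<open>\<sigma> n\<close>.  For the second and for the lower ones the previous
  rows give equations in \<open>c\<close> and \<open>\<gamma>\<close>, which follow from the first order relations \<open>H\<close> and \<open>H'\<close> for
  \<open>x\<close>; these hold because \<open>s\<close> can be non-zero only if \<open>\<alpha> = 1\<close>.  The bound \<open>N\<close> is kept for the induction
  that determines \<open>c\<close> if \<open>k = 2\<close>.\<close>

lemma flat_at_if_good:
  assumes s: "s * (1 - \<alpha>\<^sup>2) = 0" and good: "\<And>i. 0 < i \<Longrightarrow> i \<le> N \<Longrightarrow> good_coeff s i"
    and "n \<le> Suc N"
  shows "flat_at n"
  using \<open>n \<le> Suc N\<close>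
proof (induction n rule: less_induct)
  case (less n)
  have xg: "x (Suc i) = 2 * \<gamma> (Suc i) + s * \<tau> (Suc i)" if "Suc i \<le> N" for i
    using x_good good that by simp
  have H: "\<gamma> (Suc (Suc (Suc i))) - \<gamma> (Suc i) + x (Suc i) = \<alpha> * x (Suc (Suc i))" if "Suc (Suc i) \<le> N" for i
  proof -
    have "\<gamma> (Suc (Suc (Suc i))) - \<gamma> (Suc i) + x (Suc i) - \<alpha> * x (Suc (Suc i))
        = s * (1 - \<alpha>\<^sup>2) * \<gamma> (Suc (Suc i))"
      unfolding xg[OF Suc_leD[OF that]] xg[OF that]
      by (simp add: \<tau>_eq_\<gamma> \<gamma>_rec[of "Suc i"] algebra_simps power2_eq_square)
    then show ?thesis unfolding s by simp
  qed
  have H': "x (Suc (Suc i)) = \<alpha> * x (Suc i) + 2 * \<gamma> (Suc (Suc i)) - 2 * \<alpha> * \<gamma> (Suc i)" if "Suc (Suc i) \<le> N" for i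
  proof -
    have "x (Suc (Suc i)) - (\<alpha> * x (Suc i) + 2 * \<gamma> (Suc (Suc i)) - 2 * \<alpha> * \<gamma> (Suc i))
        = - (s * (1 - \<alpha>\<^sup>2) * \<gamma> (Suc i))"
      unfolding xg[OF Suc_leD[OF that]] xg[OF that]
      by (simp add: \<tau>_eq_\<gamma> \<gamma>_rec[of "Suc i"] algebra_simps power2_eq_square)
    then show ?thesis unfolding s by simp
  qed
  show ?case unfolding flat_at_def
  proof (intro allI impI)
    fix j assume j: "j < n" "odd (n + j)"
    then have "n = Suc j \<or> n = Suc (Suc (Suc j)) \<or> j + 5 \<le> n" by presburger
    then consider (top) "n = Suc j" | (second) "n = Suc (Suc (Suc j))" | (lower) "j + 5 \<le> n" by blast
    then show "\<kappa> n j = \<sigma> n"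
    proof cases
      case top
      then show ?thesis by (simp add: \<kappa>_Suc)
    next
      case second
      have "2 * \<alpha> * c (Suc j) * (\<gamma> (Suc (Suc j)) + a j * \<gamma> j)
           + (a j * a (Suc j) - \<alpha>\<^sup>2 - b (Suc j)) * \<gamma> (Suc j)
           - c (Suc j) * c (Suc (Suc j)) * \<gamma> (Suc (Suc (Suc j))) = 0" (is "?R = 0")
      proof (cases j)
        case 0
        have "Suc (Suc 0) \<le> N" using less.prems second 0 by simp
        then have x1: "\<gamma> (Suc (Suc (Suc 0))) - 1 + x (Suc 0) = \<alpha> * x (Suc (Suc 0))"
          and x0: "x (Suc 0) = 2 + s * \<alpha>"
          using H[of 0] xg[of 0] by simp_all
        have "(1 - \<alpha>\<^sup>2) * x (Suc 0) = 2 * (1 - \<alpha>\<^sup>2)"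
          using s by (auto simp: x0 algebra_simps)
        then show ?thesis
          using second_order_identity_start[OF _ _ x1] c_x[of "Suc 0"] c_x[of "Suc (Suc 0)"]
          unfolding 0 b_def a_def by (simp add: \<gamma>_rec)
      next
        case (Suc i)
        have "Suc (Suc (Suc i)) \<le> N" using less.prems second Suc by simp
        then have "\<gamma> (Suc (Suc j)) - \<gamma> j + x j = \<alpha> * x (Suc j)"
          "\<gamma> (Suc (Suc (Suc j))) - \<gamma> (Suc j) + x (Suc j) = \<alpha> * x (Suc (Suc j))"
          "x (Suc j) = \<alpha> * x j + 2 * \<gamma> (Suc j) - 2 * \<alpha> * \<gamma> j"
          using H[of i] H[of "Suc i"] H'[of i] Suc by simp_all
        from second_order_identity[OF c_x c_x c_x this] show ?thesis
          unfolding b_def a_def diff_Suc_1 .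
      qed
      then have "a (Suc j) * a (Suc (Suc j)) * c (Suc j) * h (Suc j) * (\<kappa> n j - \<sigma> n) = 0"
        using second_coefficient[of j] less.IH[of "Suc (Suc j)"] less.IH[of "Suc j"] less.prems second
        by (auto simp: flat_at_def)
      then show ?thesis
        using a_pos[of "Suc j"] a_pos[of "Suc (Suc j)"] c_pos[of j] h_pos[of "Suc j"]
        by (simp del: h.simps)
    next
      case lower
      define q where "q = n - 5"
      have n: "n = Suc (Suc (Suc (Suc (Suc q))))" using lower by (simp add: q_def)
      have "Suc (Suc (Suc (Suc q))) \<le> N" using less.prems n by simp
      then have "\<gamma> (Suc (Suc (Suc q))) - \<gamma> (Suc q) + x (Suc q) = \<alpha> * x (Suc (Suc q))"
          "\<gamma> (Suc (Suc (Suc (Suc q)))) - \<gamma> (Suc (Suc q)) + x (Suc (Suc q)) = \<alpha> * x (Suc (Suc (Suc q)))"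
          "\<gamma> n - \<gamma> (Suc (Suc (Suc q))) + x (Suc (Suc (Suc q))) = \<alpha> * x (Suc (Suc (Suc (Suc q))))"
        using H[of q] H[of "Suc q"] H[of "Suc (Suc q)"] n by simp_all
      from lower_order_identity[OF c_x c_x c_x c_x this]
      have "2 * \<alpha> * (\<gamma> (Suc (Suc (Suc (Suc q)))) + a (Suc (Suc q)) * x (Suc (Suc q)))
          - (b (Suc (Suc (Suc q))) + \<alpha>\<^sup>2) * x (Suc (Suc (Suc q)))
          - a (Suc (Suc q)) * a (Suc q) * x (Suc q) = c (Suc (Suc (Suc (Suc q)))) * \<gamma> n"
        unfolding b_def a_def diff_Suc_1 .
      then have "a (n - 2) * a (n - 1) * h (n - 2) * \<kappa> n j = c (n - 1) * \<gamma> n"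
        using lower_coefficient[of j "n - 2"] less.IH[of "n - 1"] less.IH[of "n - 2"] less.IH[of "n - 3"]
          less.IH[of "n - 4"] less.prems j lower n by simp
      also have "\<dots> = a (n - 2) * h (n - 2) * (a (n - 1) * \<sigma> n)"
        using c_h_Suc[of "Suc (Suc (Suc q))"] a_h_\<sigma>[of "Suc (Suc (Suc (Suc q)))", symmetric]
        by (simp add: n mult_ac del: h.simps)
      finally have "(a (n - 2) * a (n - 1) * h (n - 2)) * (\<kappa> n j - \<sigma> n) = 0"
        by (simp add: algebra_simps)
      then show ?thesis
        using a_pos[of "n - 2"] a_pos[of "n - 1"] h_pos[of "n - 2"] by simp
    qed
  qed
qed

section \<open>From two flat coefficients back to the recurrence coefficients\<close>

definition d :: "nat \<Rightarrow> real" where "d n = c n - 1 / 2"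

lemma d_bounds: "- 1 / 2 < d (Suc n)" "d n < 1 / 2"
  using c_pos[of n] c_less_1[of n] by (simp_all add: d_def)

lemma d_0 [simp]: "d 0 = - 1 / 2" by (simp add: d_def)

text \<open>Centred at \<open>1 / 2\<close>, the equation for the second coefficients has no constant term.\<close>

lemma second_order_equation:
  assumes "\<And>n. \<kappa> (n + 3) n = \<sigma> (n + 3)"
  shows "\<alpha> * (\<gamma> (Suc (Suc m)) * d (Suc (Suc m)) - 2 * \<alpha> * \<gamma> (Suc m) * d (Suc m) + \<gamma> m * d m)
     + 2 * d (Suc m) * (\<tau> (Suc (Suc m)) * d (Suc (Suc m)) - \<tau> m * d m) = 0" (is "?l = 0")
proof -
  have *: "\<kappa> (Suc (Suc (Suc n))) n = \<sigma> (Suc (Suc (Suc n)))" for n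
    using assms[of n] by (simp add: numeral_3_eq_3)
  have "2 * \<alpha> * c (Suc m) * (\<gamma> (Suc (Suc m)) + a m * \<gamma> m)
           + (a m * a (Suc m) - \<alpha>\<^sup>2 - b (Suc m)) * \<gamma> (Suc m)
           - c (Suc m) * c (Suc (Suc m)) * \<gamma> (Suc (Suc (Suc m))) = 0" (is "?R = 0")
  proof -
    have "\<kappa> (Suc (Suc m)) (m - 1) = \<sigma> (Suc (Suc m))" if "m > 0" using *[of "m - 1"] that by simp
    moreover have "\<kappa> (Suc m) (m - 2) = \<sigma> (Suc m)" if "m > 1"
      using *[of "m - 2"] that by (simp add: Suc_diff_Suc numeral_2_eq_2)
    ultimately show ?thesis using second_coefficient[of m] *[of m] by simp
  qed
  moreover have "?l = - ?R"
    unfolding \<tau>_eq_\<gamma> b_def a_def d_def by (simp add: \<gamma>_rec algebra_simps power2_eq_square)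
  ultimately show ?thesis by simp
qed

text \<open>The initial value \<open>d 0 = - 1 / 2\<close> makes the identity true for \<open>n = 0\<close>, and the second order equation
  propagates it.  For non-zero terms, \<open>z n = \<tau> n / (\<gamma> n * d n)\<close> satisfies
  \<open>z (n + 1) - z n = 2 * \<tau> n * \<tau> (n + 1) / (\<alpha> * \<gamma> n * \<gamma> (n + 1))\<close>, which is free of \<open>d\<close>.\<close>

lemma first_integral:
  assumes flat2: "\<And>n. \<kappa> (n + 3) n = \<sigma> (n + 3)"
  shows "\<alpha> * (\<tau> (Suc n) * \<gamma> n * d n - \<tau> n * \<gamma> (Suc n) * d (Suc n)) = 2 * \<tau> n * \<tau> (Suc n) * d n * d (Suc n)"
    (is "?I n")
proof (induction n)
  case 0
  show ?case by simp
next
  case (Suc n)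
  have "\<alpha> * (\<tau> (Suc (Suc n)) * \<gamma> (Suc n) * d (Suc n) - \<tau> (Suc n) * \<gamma> (Suc (Suc n)) * d (Suc (Suc n)))
       - 2 * \<tau> (Suc n) * \<tau> (Suc (Suc n)) * d (Suc n) * d (Suc (Suc n))
     = (\<alpha> * (\<tau> (Suc n) * \<gamma> n * d n - \<tau> n * \<gamma> (Suc n) * d (Suc n)) - 2 * \<tau> n * \<tau> (Suc n) * d n * d (Suc n))
       - \<tau> (Suc n) * (\<alpha> * (\<gamma> (Suc (Suc n)) * d (Suc (Suc n)) - 2 * \<alpha> * \<gamma> (Suc n) * d (Suc n) + \<gamma> n * d n)
           + 2 * d (Suc n) * (\<tau> (Suc (Suc n)) * d (Suc (Suc n)) - \<tau> n * d n))"
    by (simp add: \<tau>_rec[of n] algebra_simps)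
  then show ?case using second_order_equation[OF flat2, of n] Suc.IH by simp
qed

text \<open>For \<open>k = 1\<close> the first integral determines \<open>c (n + 1)\<close> from \<open>c n\<close>.\<close>

lemma good_coeff_if_k_eq_1:
  assumes k: "k = 1" and flat2: "\<And>n. \<kappa> (n + 3) n = \<sigma> (n + 3)" and "0 < n"
  shows "good_coeff (1 / c 1 - 2) n"
proof -
  have c1: "c 1 > 0" "c 1 < 1" using c_pos[of 0] c_less_1[of 1] by simp_all
  define s where "s = 1 / c 1 - 2"
  have s: "s > - 1" using c1 by (simp add: s_def field_simps)
  have "d (Suc i) * (2 * real (Suc i) + s) = - s / 2" for i
  proof (induction i)
    case 0
    then show ?case using c1 by (simp add: d_def s_def field_simps)
  next
    case (Suc i)
    let ?m = "real (Suc i)"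
    have I: "d (Suc (Suc i)) * (?m + 1 + 2 * d (Suc i)) = ?m * d (Suc i)"
      using first_integral[OF flat2, of "Suc i"] by (simp add: values_at_k_eq_1[OF k] algebra_simps)
    \<comment> \<open>Multiplied by \<open>2 m + s\<close>, the induction hypothesis makes the first integral linear in \<open>d (m + 1)\<close>.\<close>
    have "d (Suc (Suc i)) * (?m * (2 * (?m + 1) + s))
        = d (Suc (Suc i)) * ((?m + 1) * (2 * ?m + s) + 2 * (d (Suc i) * (2 * ?m + s)))"
      unfolding Suc.IH by (simp add: algebra_simps)
    also have "\<dots> = d (Suc (Suc i)) * (?m + 1 + 2 * d (Suc i)) * (2 * ?m + s)"
      by (simp only: algebra_simps)
    also have "\<dots> = ?m * (d (Suc i) * (2 * ?m + s))" unfolding I by (simp only: mult_ac)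
    finally have "?m * (d (Suc (Suc i)) * (2 * (?m + 1) + s)) = ?m * (- s / 2)"
      unfolding Suc.IH by (simp only: mult_ac)
    then have "d (Suc (Suc i)) * (2 * (?m + 1) + s) = - s / 2"
      by (simp only: mult_cancel_left) simp
    then show ?case by (simp add: algebra_simps)
  qed
  from this[of "n - 1"] have "d n * (2 * real n + s) = - s / 2" using \<open>0 < n\<close> by simp
  then show ?thesis
    unfolding good_coeff_def s_def[symmetric] by (simp add: values_at_k_eq_1[OF k] d_def algebra_simps)
qed

end

subsection \<open>Sieved sequences\<close>

context chebyshev_parameter
begin

lemma \<alpha>_eq: "k \<ge> 2 \<Longrightarrow> \<alpha> = cos (pi / real k)"
proof -
  assume "k \<ge> 2"
  then have "pi / real k \<le> pi / 2" by (intro divide_left_mono) auto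
  then have "0 \<le> cos (pi / real k)" by (intro cos_ge_zero) (auto intro: order.trans[of _ 0])
  then show ?thesis by (simp add: \<alpha>_def)
qed

lemma \<tau>_eq_cos: "k \<ge> 2 \<Longrightarrow> \<tau> n = cos (real n * pi / real k)"
  unfolding \<tau>_def by (simp add: \<alpha>_eq poly_cheb_T_cos)

lemma sin_pi_k_pos: "k \<ge> 2 \<Longrightarrow> 0 < sin (pi / real k)"
  by (intro sin_gt_zero) (auto simp: field_simps)

lemma \<gamma>_sin: "k \<ge> 2 \<Longrightarrow> \<gamma> n * sin (pi / real k) = sin (real n * pi / real k)"
  using poly_cheb_U_cos[of "n - 1" "pi / real k"]
  by (cases n) (simp_all add: \<gamma>_def cheb_u_def \<alpha>_eq)

lemma \<gamma>_eq_0_iff: "k \<ge> 2 \<Longrightarrow> \<gamma> n = 0 \<longleftrightarrow> k dvd n"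
proof -
  assume k: "k \<ge> 2"
  have "\<gamma> n = 0 \<longleftrightarrow> sin (real n * pi / real k) = 0"
    using \<gamma>_sin[OF k, of n] sin_pi_k_pos[OF k] by (metis less_irrefl mult_eq_0_iff)
  also have "\<dots> \<longleftrightarrow> (\<exists>i::int. real n = of_int i * real k)"
    using k by (simp add: sin_zero_iff_int2 field_simps)
  also have "\<dots> \<longleftrightarrow> (\<exists>i::int. int n = i * int k)"
    by (metis of_int_eq_iff of_int_mult of_int_of_nat_eq)
  also have "\<dots> \<longleftrightarrow> int k dvd int n" by (auto simp: dvd_def mult.commute)
  finally show ?thesis by simp
qed

lemma \<tau>_mult_k: "k \<ge> 2 \<Longrightarrow> \<tau> (m * k) \<noteq> 0"
  using cos_int_times_real[of "int m"] by (simp add: \<tau>_eq_cos)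

lemma \<alpha>_nonzero: "k \<ge> 3 \<Longrightarrow> \<alpha> \<noteq> 0"
proof -
  assume "k \<ge> 3"
  then have "pi / real k < pi / 2" by (intro divide_strict_left_mono) auto
  then have "0 < cos (pi / real k)" by (intro cos_gt_zero_pi) (auto intro: less_le_trans[of _ 0])
  then show ?thesis by (simp add: \<alpha>_def)
qed

end

context rw_askey
begin

lemma good_coeff_0_iff: "k \<ge> 2 \<Longrightarrow> good_coeff 0 n \<longleftrightarrow> k dvd n \<or> c n = 1 / 2"
  using \<gamma>_eq_0_iff[of n] by (auto simp: good_coeff_def)

text \<open>At \<open>n = m * k - 1\<close> the first integral degenerates because of \<open>\<gamma> (m * k) = 0\<close>: it becomes
  \<open>d n * (1 + 2 * d (n + 1)) = 0\<close>, whose second factor is \<open>2 * c (n + 1) > 0\<close>.  From there the zeros of \<open>d\<close>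
  propagate downwards to the previous multiple of \<open>k\<close>, where \<open>\<gamma> n = 0\<close> stops them.  Where \<open>\<tau> (n + 1) = 0\<close>
  the first integral carries no information, and the second order equation with the two zeros above \<open>n\<close>
  replaces it.\<close>

lemma d_eq_0_below_multiple_of_k:
  assumes k: "k \<ge> 3" and flat2: "\<And>n. \<kappa> (n + 3) n = \<sigma> (n + 3)"
    and "m \<ge> 1" "1 \<le> i" "i < k"
  shows "d (m * k - i) = 0"
  using \<open>1 \<le> i\<close> \<open>i < k\<close>
proof (induction i rule: less_induct)
  case (less i)
  have k2: "k \<ge> 2" using k by simp
  have \<alpha>: "\<alpha> \<noteq> 0" by (rule \<alpha>_nonzero[OF k])
  have mk: "k \<le> m * k" using \<open>m \<ge> 1\<close> by simp
  define e where "e = \<tau> (m * k)"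
  have e: "e \<noteq> 0" unfolding e_def by (rule \<tau>_mult_k[OF k2])
  have \<gamma>0: "\<gamma> (m * k) = 0" using \<gamma>_eq_0_iff[OF k2] by simp
  have s1: "Suc (m * k - 1) = m * k" using mk k by simp
  have \<gamma>1: "\<gamma> (m * k - 1) = - e"
    using two_\<tau>[of "m * k - 1"] \<tau>_eq_\<gamma>[of "m * k"] \<gamma>0 unfolding s1 e_def by simp
  have \<tau>1: "\<tau> (m * k - 1) = \<alpha> * e"
    using \<tau>_eq_\<gamma>[of "m * k - 1"] \<gamma>0 \<gamma>1 unfolding s1 by simp
  define n where "n = m * k - i"
  have sn: "Suc n = m * k - (i - 1)" using less.prems mk unfolding n_def by linarith
  have "\<not> k dvd n"
  proof
    assume "k dvd n"
    then have "k dvd m * k - n" by (simp add: dvd_diff_nat)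
    moreover have "m * k - n = i"
      unfolding n_def using less.prems mk by (intro diff_diff_cancel) linarith
    ultimately show False using less.prems by (auto dest: dvd_imp_le)
  qed
  then have \<gamma>n: "\<gamma> n \<noteq> 0" using \<gamma>_eq_0_iff[OF k2] by simp
  show ?case unfolding n_def[symmetric]
  proof (cases "i = 1")
    case True
    then have n: "n = m * k - 1" by (simp add: n_def)
    have "\<alpha> * (e * e) * (d n * (1 + 2 * d (Suc n))) = 0"
      using first_integral[OF flat2, of n] unfolding n s1 \<gamma>0 \<gamma>1 \<tau>1 e_def[symmetric]
      by (simp add: algebra_simps)
    then show "d n = 0" using d_bounds(1)[of n] \<alpha> e by simp
  next
    case False
    have dS: "d (Suc n) = 0" unfolding sn using less.prems False by (intro less.IH) auto
    show "d n = 0"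
    proof (cases "\<tau> (Suc n) = 0")
      case False
      then show ?thesis using first_integral[OF flat2, of n] \<alpha> \<gamma>n dS by simp
    next
      case True
      then have "i \<noteq> 2" using \<tau>1 \<alpha> e sn by auto
      moreover have "Suc (Suc n) = m * k - (i - 2)" using less.prems mk \<open>i \<noteq> 1\<close> unfolding n_def by linarith
      ultimately have "d (Suc (Suc n)) = 0"
        using less.prems \<open>i \<noteq> 1\<close> less.IH[of "i - 2"] by simp
      then show ?thesis using second_order_equation[OF flat2, of n] \<alpha> \<gamma>n dS by simp
    qed
  qed
qed

text \<open>For \<open>k = 2\<close> we have \<open>\<alpha> = 0\<close>, and for odd \<open>n\<close> the second coefficients only give \<open>d n = 0\<close> or
  \<open>d (n - 1) + d (n + 1) = 0\<close>.  The latter is impossible for \<open>n = 1\<close> by \<open>d 0 = - 1 / 2\<close>.  For larger \<open>n\<close>, when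
  the smaller odd indices are settled, all rows up to \<open>n\<close> are flat, and any one of the lower coefficients
  of row \<open>n + 2\<close> having the value \<open>\<sigma> (n + 2)\<close> yields \<open>c n = 1 / 2\<close>.\<close>

lemma good_coeff_if_k_eq_2:
  assumes k: "k = 2" and flat2: "\<And>n. \<kappa> (n + 3) n = \<sigma> (n + 3)"
    and flat3: "\<And>n. \<exists>i\<le>n div 2. \<kappa> (n + 5) (n - 2 * i) = \<sigma> (n + 5)"
  shows "0 < n \<Longrightarrow> good_coeff 0 n"
proof (induction n rule: less_induct)
  case (less n)
  have k2: "k \<ge> 2" using k by simp
  have \<alpha>: "\<alpha> = 0" unfolding \<alpha>_def by (simp add: k)
  consider "even n" | "n = 1" | "odd n" "n \<ge> 3" using less.prems by (cases "n \<le> 2") (auto simp: le_Suc_eq numeral_2_eq_2)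
  then show ?case
  proof cases
    case 1
    then show ?thesis unfolding good_coeff_0_iff[OF k2] by (simp add: k)
  next
    case 2
    have "d 1 * (1 / 2 - d 2) = 0"
      using second_order_equation[OF flat2, of 0] by (simp add: \<alpha> \<tau>_rec numeral_2_eq_2 algebra_simps)
    then have "d 1 = 0" using d_bounds(2)[of 2] by simp
    then show ?thesis using 2 by (simp add: good_coeff_0_iff[OF k2] d_def)
  next
    case 3
    have flat: "flat_at i" if "i \<le> n" for i
      using flat_at_if_good[of 0 "n - 1" i] less.IH that 3 by force
    define q where "q = n - 3"
    have n: "n = Suc (Suc (Suc q))" using 3 by (simp add: q_def)
    obtain i where i: "i \<le> q div 2" "\<kappa> (Suc (Suc n)) (q - 2 * i) = \<sigma> (Suc (Suc n))"
      using flat3[of q] by (auto simp: n numeral_eq_Suc)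
    have "2 * i \<le> q" using i(1) by simp
    have "a n * a (Suc n) * h n * \<sigma> (Suc (Suc n)) = - b n * x n - a (n - 1) * a (n - 2) * x (n - 2)"
      using lower_coefficient[of "q - 2 * i" n] flat 3 \<open>2 * i \<le> q\<close> i(2) by (simp add: \<alpha> n)
    moreover have "a n * a (Suc n) * h n * \<sigma> (Suc (Suc n)) = c (Suc n) * \<gamma> (Suc (Suc n))"
      using c_h_Suc[of n] unfolding a_h_\<sigma>[of "Suc n", symmetric] by (simp add: mult_ac del: h.simps)
    moreover have "\<gamma> (Suc (Suc n)) = - \<gamma> n" by (simp add: \<gamma>_rec \<alpha>)
    moreover have c2: "c (n - 2) = 1 / 2"
      using less.IH[of "n - 2"] 3 unfolding good_coeff_0_iff[OF k2] by (auto simp: k)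
    moreover have "x (n - 2) = - 2 * \<gamma> n"
      using c_x[of "n - 2"] unfolding c2 by (simp add: n \<gamma>_rec \<alpha>)
    ultimately have "c (Suc n) * \<gamma> n = b n * x n - a (n - 1) * \<gamma> n"
      by (simp add: a_def)
    then have "c n * (c (Suc n) * \<gamma> n) = c n * (b n * x n - a (n - 1) * \<gamma> n)" by simp
    also have "\<dots> = b n * (c n * x n) - c n * a (n - 1) * \<gamma> n" by (simp add: algebra_simps)
    also have "\<dots> = a n * c (Suc n) * \<gamma> n" unfolding c_x b_def by (simp add: algebra_simps)
    finally have "(c n - a n) * (c (Suc n) * \<gamma> n) = 0" by (simp add: algebra_simps)
    moreover have "\<gamma> n \<noteq> 0" using \<gamma>_eq_0_iff[OF k2] 3 k by simp
    ultimately have "c n = 1 / 2" using c_pos[of n] by (simp add: a_def)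
    then show ?thesis by (simp add: good_coeff_0_iff[OF k2])
  qed
qed

lemma good_coeff_if_k_ge_2:
  assumes k: "k \<ge> 2" and flat2: "\<And>n. \<kappa> (n + 3) n = \<sigma> (n + 3)"
    and flat3: "\<And>n. \<exists>i\<le>n div 2. \<kappa> (n + 5) (n - 2 * i) = \<sigma> (n + 5)"
    and "0 < n"
  shows "good_coeff 0 n"
proof (cases "k = 2")
  case True
  then show ?thesis using good_coeff_if_k_eq_2 assms by blast
next
  case False
  show ?thesis
  proof (cases "k dvd n")
    case nd: False
    define m where "m = n div k + 1"
    define i where "i = k - n mod k"
    have "n mod k < k" "0 < n mod k" using k nd by (auto simp: dvd_eq_mod_eq_0)
    then have "1 \<le> i" "i < k" by (auto simp: i_def)
    moreover have "m * k - i = n"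
    proof -
      have "m * k = n div k * k + k" by (simp add: m_def)
      moreover have "n = n div k * k + n mod k" by simp
      ultimately show ?thesis using \<open>n mod k < k\<close> unfolding i_def by linarith
    qed
    ultimately have "d n = 0"
      using d_eq_0_below_multiple_of_k[OF _ flat2, of m i] False k by (simp add: m_def)
    then show ?thesis by (simp add: good_coeff_0_iff[OF k] d_def)
  qed (simp add: good_coeff_0_iff[OF k])
qed

section \<open>The equivalences for a recurrence and its functional\<close>

text \<open>For \<open>k = 1\<close> the value of \<open>s\<close> is dictated by \<open>n = 1\<close>, where \<open>c 1 = 1 / (2 + s)\<close>.\<close>

definition s\<^sub>0 :: real where "s\<^sub>0 = (if k = 1 then 1 / c 1 - 2 else 0)"

definition two_flat :: bool where
  "two_flat \<longleftrightarrow> (\<forall>n. \<kappa> (n + 3) n = \<sigma> (n + 3)) \<and> (\<forall>n. \<exists>i\<le>n div 2. \<kappa> (n + 5) (n - 2 * i) = \<sigma> (n + 5))"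

lemma flat_if_all_good:
  assumes "k \<ge> 1" "\<forall>n>0. good_coeff s\<^sub>0 n"
  shows "flat_at n"
proof (rule flat_at_if_good[of s\<^sub>0 n n])
  show "s\<^sub>0 * (1 - \<alpha>\<^sup>2) = 0" by (simp add: s\<^sub>0_def \<alpha>_def)
qed (use assms in auto)

lemma two_flat_if_flat:
  assumes "\<forall>n. flat_at n"
  shows two_flat
proof -
  have "\<kappa> n j = \<sigma> n" if "j < n" "odd (n + j)" for n j
    using assms that by (auto simp: flat_at_def)
  then show ?thesis unfolding two_flat_def by (auto intro!: exI[of _ 0])
qed

lemma all_good_if_two_flat:
  assumes "k \<ge> 1" two_flat "0 < n"
  shows "good_coeff s\<^sub>0 n"
proof (cases "k = 1")
  case True
  then have "s\<^sub>0 = 1 / c 1 - 2" unfolding s\<^sub>0_def by simp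
  then show ?thesis
    using good_coeff_if_k_eq_1[OF True _ \<open>0 < n\<close>] assms(2) unfolding two_flat_def by simp
next
  case False
  then show ?thesis
    using good_coeff_if_k_ge_2[OF _ _ _ \<open>0 < n\<close>] assms(1,2) by (simp add: s\<^sub>0_def two_flat_def)
qed

lemma flat_iff_orthogonal:
  "(\<forall>n. flat_at n) \<longleftrightarrow> (\<forall>n. \<forall>j\<le>n. L ([:1, 0, -1:] * D (P (Suc (Suc n))) * P j) = 0)"
  using flat_if_orthogonal orthogonal_if_multiple[OF D_P_eq] by (meson less_Suc_eq_le)

definition P_star :: "nat \<Rightarrow> real poly" where "P_star n = smult (1 / poly (S n) 1) (S n)"

lemma flat_iff_multiple:
  "(\<forall>n. flat_at n) \<longleftrightarrow> (\<forall>n. D (P (Suc n)) = smult (poly (D (P (Suc n))) 1) (P_star n))"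
proof
  assume flat: "\<forall>n. flat_at n"
  show "\<forall>n. D (P (Suc n)) = smult (poly (D (P (Suc n))) 1) (P_star n)"
  proof
    fix n
    have "D (P (Suc n)) = smult (\<sigma> (Suc n)) (S n)" using flat by (intro D_P_eq) simp
    then show "D (P (Suc n)) = smult (poly (D (P (Suc n))) 1) (P_star n)"
      using poly_S_1[of n] by (simp add: P_star_def)
  qed
next
  assume *: "\<forall>n. D (P (Suc n)) = smult (poly (D (P (Suc n))) 1) (P_star n)"
  show "\<forall>n. flat_at n"
    unfolding flat_iff_orthogonal
  proof (intro allI impI)
    fix n j :: nat assume "j \<le> n"
    show "L ([:1, 0, -1:] * D (P (Suc (Suc n))) * P j) = 0"
      by (rule orthogonal_if_multiple[where r = "poly (D (P (Suc (Suc n)))) 1 / poly (S (Suc n)) 1"])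
         (use *[rule_format, of "Suc n"] \<open>j \<le> n\<close> in \<open>simp_all add: P_star_def\<close>)
  qed
qed

lemma P_star_orthogonal:
  "degree (P_star n) = n" "poly (P_star n) 1 = 1"
  "m \<noteq> n \<Longrightarrow> L ([:1, 0, -1:] * (P_star m * P_star n)) = 0"
  "L ([:1, 0, -1:] * (P_star n * P_star n)) \<noteq> 0"
proof -
  have L: "L ([:1, 0, -1:] * (P_star m * P_star n))
      = L ([:1, 0, -1:] * S m * S n) / (poly (S m) 1 * poly (S n) 1)" for m n
    by (simp only: P_star_def mult_smult_left mult_smult_right L_smult mult.assoc) simp
  show "degree (P_star n) = n" "poly (P_star n) 1 = 1"
    using poly_S_1[of n] by (simp_all add: P_star_def degree_S)
  show "m \<noteq> n \<Longrightarrow> L ([:1, 0, -1:] * (P_star m * P_star n)) = 0"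
    unfolding L L_weight_S_S by auto
  show "L ([:1, 0, -1:] * (P_star n * P_star n)) \<noteq> 0"
    unfolding L L_weight_S_S using poly_S_1[of n] h_pos[of n] a_pos[of n] a_pos[of "Suc n"] by simp
qed

section \<open>Moments for \<open>k = 1\<close>\<close>

text \<open>For \<open>k = 1\<close> the operator is differentiation; the commutation relation suffices to see this on powers.\<close>

lemma D_power:
  assumes "k = 1"
  shows "D (pX ^ n) = smult (real n) (pX ^ (n - 1))"
proof (induction n rule: induct_nat_012)
  case (ge2 n)
  have "D (pX ^ Suc (Suc n)) + pX * (pX * D (pX ^ n)) = smult 2 (pX * D (pX ^ Suc n))"
    using D_commutation[of "pX ^ n"] by (simp add: values_at_k_eq_1[OF assms])
  moreover have "pX * (pX * D (pX ^ n)) = smult (real n) (pX ^ Suc n)"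
    unfolding ge2 by (cases n) simp_all
  ultimately have "D (pX ^ Suc (Suc n)) = smult 2 (pX * D (pX ^ Suc n)) - smult (real n) (pX ^ Suc n)"
    by (simp add: eq_diff_eq)
  also have "\<dots> = smult (real (Suc (Suc n))) (pX ^ Suc n)"
    unfolding ge2 by (simp add: smult_diff_left[symmetric] add.commute)
  finally show ?case by simp
qed simp_all

text \<open>By flatness, both functionals annihilate \<open>P n\<close> for \<open>n \<ge> 2\<close>, so only the values at \<open>P 0\<close> and \<open>P 1\<close>
  have to be compared; \<open>L (x * P 1) = c 1\<close>.\<close>

lemma L_weight_D:
  assumes "\<forall>n. flat_at n"
  shows "L ([:1, 0, -1:] * D p) = (1 / c 1 - 1) * L (pX * p)"
proof (induction p rule: P_induct)
  case (add p q)
  then show ?case by (simp only: D_add distrib_left L_add)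
next
  case (smult r p)
  then show ?case by (simp only: D_smult mult_smult_right L_smult mult.left_commute)
next
  case (basis n)
  have X1: "L (pX * P n) = (if n = 1 then c 1 else 0)"
    using L_P_P[of 1 n] by auto
  consider "n = 0" | "n = 1" | m where "n = Suc (Suc m)" by (metis One_nat_def not0_implies_Suc)
  then show ?case
  proof cases
    case 1
    then show ?thesis using X1 by simp
  next
    case 2
    have "L ([:1, 0, -1:] * 1) = 1 - c 1"
      unfolding one_minus_sq_times using X1 2 by (simp add: L_diff L_one)
    moreover have "(1 / c 1 - 1) * c 1 = 1 - c 1" using c_pos[of 0] by (simp add: field_simps)
    ultimately show ?thesis unfolding X1 using 2 by simp
  next
    case 3
    have "L ([:1, 0, -1:] * D (P n) * P 0) = 0"
      using assms unfolding flat_iff_orthogonal 3 by blast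
    then show ?thesis unfolding X1 using 3 by simp
  qed
qed

lemma L_moments:
  assumes "k = 1" "\<forall>n. flat_at n"
  shows "real n * (L (pX ^ (n - 1)) - L (pX ^ Suc n)) = (1 / c 1 - 1) * L (pX ^ Suc n)"
proof -
  have "[:1, 0, -1:] * D (pX ^ n) = smult (real n) (pX ^ (n - 1) - pX ^ Suc n)"
    unfolding one_minus_sq_times D_power[OF assms(1)] by (cases n) (simp_all add: smult_diff_right)
  then show ?thesis using L_weight_D[OF assms(2), of "pX ^ n"] by (simp add: L_smult L_diff)
qed

end

lemma degree_pX_power: "degree (pX ^ n) = n"
  by (simp add: pX_def degree_power_eq)

text \<open>For \<open>n = 0\<close> the recurrence says that the first moment is zero, and for larger \<open>n\<close> it determines the
  moments in steps of two; only the total mass remains free.\<close>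

lemma functional_eq_by_moments:
  fixes L M :: "real poly \<Rightarrow> real"
  assumes L: "\<And>p q. L (p + q) = L p + L q" "\<And>r p. L (smult r p) = r * L p" "L 1 = 1"
    and M: "\<And>p q. M (p + q) = M p + M q" "\<And>r p. M (smult r p) = r * M p"
    and C: "C > 0"
    and L_rec: "\<And>n. real n * (L (pX ^ (n - 1)) - L (pX ^ Suc n)) = C * L (pX ^ Suc n)"
    and M_rec: "\<And>n. real n * (M (pX ^ (n - 1)) - M (pX ^ Suc n)) = C * M (pX ^ Suc n)"
  shows "M p = M 1 * L p"
proof -
  have basis: "M (pX ^ n) = M 1 * L (pX ^ n)" for n
  proof (induction n rule: less_induct)
    case (less n)
    show ?case
    proof (cases n)
      case 0
      then show ?thesis by (simp add: L)
    next
      case (Suc m)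
      have "(C + real m) * M (pX ^ n) = real m * M (pX ^ (m - 1))"
        using M_rec[of m] Suc by (simp add: algebra_simps)
      also have "\<dots> = M 1 * (real m * L (pX ^ (m - 1)))" using less[of "m - 1"] Suc by simp
      also have "real m * L (pX ^ (m - 1)) = (C + real m) * L (pX ^ n)"
        using L_rec[of m] Suc by (simp add: algebra_simps)
      finally have "(C + real m) * M (pX ^ n) = (C + real m) * (M 1 * L (pX ^ n))" by simp
      then show ?thesis using C by (simp add: add_pos_nonneg less_imp_neq[symmetric])
    qed
  qed
  have "pX ^ 0 \<noteq> 0" by simp
  from degree_pX_power this show ?thesis
    by (induction p rule: graded_basis_induct) (simp_all add: L M basis algebra_simps)
qed

section \<open>Measures on \<open>[-1, 1]\<close>\<close>

text \<open>The complement of the support is a union of open null sets, and by the Lindeloef property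
  countably many of them suffice.\<close>

lemma AE_in_supp:
  fixes \<mu> :: "real measure"
  assumes "sets \<mu> = sets borel"
  shows "AE x in \<mu>. x \<in> supp \<mu>"
proof -
  define F where "F = {U. open U \<and> emeasure \<mu> U = 0}"
  obtain F' where F': "F' \<subseteq> F" "countable F'" "\<Union>F' = \<Union>F"
    using Lindelof[of F] by (auto simp: F_def)
  have "(\<Union>U\<in>F'. U) \<in> null_sets \<mu>"
    using F'(1,2) assms by (intro null_sets_UN') (auto simp: F_def null_sets_def)
  then have "\<Union>F \<in> null_sets \<mu>" using F'(3) by simp
  moreover have "- supp \<mu> \<subseteq> \<Union>F" by (auto simp: supp_def F_def not_gr_zero)
  ultimately show ?thesis by (intro AE_I'[of "\<Union>F"]) auto
qed

lemma
  assumes "orthogonalization_measure \<mu>"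
  shows AE_orthogonalization_measure: "AE x in \<mu>. -1 \<le> x \<and> x \<le> 1"
    and integrable_poly: "integrable \<mu> (poly p)"
proof -
  interpret prob_space \<mu> using assms by (simp add: orthogonalization_measure_def)
  have sets: "sets \<mu> = sets borel" and supp: "supp \<mu> \<subseteq> {-1..1}"
    using assms by (simp_all add: orthogonalization_measure_def)
  show AE: "AE x in \<mu>. -1 \<le> x \<and> x \<le> 1"
    using AE_in_supp[OF sets] by eventually_elim (use supp in auto)
  have "compact (poly p ` {-1..1})"
    by (intro compact_continuous_image continuous_intros) auto
  then obtain B where B: "\<And>x. -1 \<le> x \<Longrightarrow> x \<le> 1 \<Longrightarrow> norm (poly p x) \<le> B"
    by (meson bounded_iff compact_imp_bounded atLeastAtMost_iff imageI)
  have "poly p \<in> borel_measurable borel"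
    by (intro borel_measurable_continuous_onI continuous_intros)
  then have "poly p \<in> borel_measurable \<mu>" using measurable_cong_sets[OF sets refl] by blast
  then show "integrable \<mu> (poly p)"
    using AE B by (intro integrable_const_bound[of _ B]) auto
qed

lemma
  fixes \<nu> :: "real measure" and p q :: "real poly"
  assumes "\<And>p. integrable \<nu> (poly p)"
  shows integral_poly_add: "(\<integral>x. poly (p + q) x \<partial>\<nu>) = (\<integral>x. poly p x \<partial>\<nu>) + (\<integral>x. poly q x \<partial>\<nu>)"
    and integral_poly_diff: "(\<integral>x. poly (p - q) x \<partial>\<nu>) = (\<integral>x. poly p x \<partial>\<nu>) - (\<integral>x. poly q x \<partial>\<nu>)"
proof -
  have "poly (p + q) = (\<lambda>x. poly p x + poly q x)" "poly (p - q) = (\<lambda>x. poly p x - poly q x)"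
    by (auto simp: fun_eq_iff)
  then show "(\<integral>x. poly (p + q) x \<partial>\<nu>) = (\<integral>x. poly p x \<partial>\<nu>) + (\<integral>x. poly q x \<partial>\<nu>)"
    and "(\<integral>x. poly (p - q) x \<partial>\<nu>) = (\<integral>x. poly p x \<partial>\<nu>) - (\<integral>x. poly q x \<partial>\<nu>)"
    using Bochner_Integration.integral_add[OF assms assms] Bochner_Integration.integral_diff[OF assms assms]
    by simp_all
qed

lemma integral_poly_smult:
  fixes \<nu> :: "real measure" and p :: "real poly"
  shows "(\<integral>x. poly (smult r p) x \<partial>\<nu>) = r * (\<integral>x. poly p x \<partial>\<nu>)"
proof -
  have "poly (smult r p) = (\<lambda>x. r * poly p x)" by (auto simp: fun_eq_iff)
  then show ?thesis by simp
qed

text \<open>The definite description in \<open>ops\<close> is resolved by any sequence with the required properties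
  and non-zero square norms.\<close>

lemma ops_eqI:
  fixes \<nu> :: "real measure"
  assumes int: "\<And>p. integrable \<nu> (poly p)"
    and R: "\<And>n. degree (R n) = n" "\<And>n. poly (R n) 1 = 1"
      "\<And>m n. m \<noteq> n \<Longrightarrow> (\<integral>x. poly (R m * R n) x \<partial>\<nu>) = 0"
    and norm: "\<And>n. (\<integral>x. poly (R n * R n) x \<partial>\<nu>) \<noteq> 0"
  shows "ops \<nu> = R"
  unfolding ops_def
proof (rule the_equality)
  show "normalized_ops \<nu> R" using R by (simp add: normalized_ops_def)
next
  fix Q assume Q: "normalized_ops \<nu> Q"
  show "Q = R"
    by (rule orthogonal_sequence_unique[where \<Lambda> = "\<lambda>p. \<integral>x. poly p x \<partial>\<nu>"])
       (use Q R norm in \<open>simp_all add: normalized_ops_def integral_poly_add[OF int] integral_poly_smult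
          del: poly_add poly_smult\<close>)
qed

lemma star_measure_poly:
  assumes "orthogonalization_measure \<mu>"
  shows "integrable (star_measure \<mu>) (poly p)"
    and "(\<integral>x. poly p x \<partial>star_measure \<mu>) = (\<integral>x. poly ([:1, 0, -1:] * p) x \<partial>\<mu>)"
proof -
  have sets: "sets \<mu> = sets borel" using assms by (simp add: orthogonalization_measure_def)
  have m: "poly p \<in> borel_measurable \<mu>" for p :: "real poly"
    using integrable_poly[OF assms] by (rule borel_measurable_integrable)
  have w: "poly [:1, 0, -1:] = (\<lambda>x::real. 1 - x\<^sup>2)" by (auto simp: power2_eq_square)
  have mw: "(\<lambda>x. 1 - x\<^sup>2) \<in> borel_measurable \<mu>" using m[of "[:1, 0, -1:]"] unfolding w .
  have AE: "AE x in \<mu>. 0 \<le> 1 - x\<^sup>2"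
    using AE_orthogonalization_measure[OF assms]
    by eventually_elim (simp add: abs_square_le_1 abs_le_iff)
  have eq: "(\<lambda>x. (1 - x\<^sup>2) * poly p x) = poly ([:1, 0, -1:] * p)"
    by (rule ext) (simp only: poly_mult w)
  show "integrable (star_measure \<mu>) (poly p)"
    unfolding star_measure_def integrable_real_density[OF mw AE m] eq by (rule integrable_poly[OF assms])
  show "(\<integral>x. poly p x \<partial>star_measure \<mu>) = (\<integral>x. poly ([:1, 0, -1:] * p) x \<partial>\<mu>)"
    unfolding star_measure_def integral_real_density[OF mw AE m] eq ..
qed

section \<open>Moments of the ultraspherical measure\<close>

text \<open>The substitution \<open>t = (1 + x) / 2\<close> turns the weight into the integrand of a Beta integral, up to the
  factor \<open>4 powr A\<close>.\<close>

lemma integrable_ultraspherical_weight: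
  fixes A :: real assumes "A > -1"
  shows "integrable lborel (\<lambda>x. indicator {-1<..<1} x * (1 - x\<^sup>2) powr A)"
proof -
  define g :: "real \<Rightarrow> real" where "g t = t powr A * (1 - t) powr A" for t
  have g: "g \<in> borel_measurable borel" unfolding g_def by measurable
  have "g integrable_on {0..1}"
    using has_integral_Beta_real[of "A + 1" "A + 1"] assms unfolding g_def by (auto simp: integrable_on_def)
  then have "g absolutely_integrable_on {0..1}"
    by (rule nonnegative_absolutely_integrable_1) (simp add: g_def)
  then have "set_integrable lborel {0..1} g"
    unfolding set_integrable_def using g by (subst (asm) integrable_completion) auto
  then have "integrable lborel (\<lambda>x. indicator {0..1} (1 / 2 + 1 / 2 * x) *\<^sub>R g (1 / 2 + 1 / 2 * x))"
    unfolding set_integrable_def by (rule lborel_integrable_real_affine) simp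
  then have "integrable lborel (\<lambda>x. 4 powr A * (indicator {0..1} (1 / 2 + 1 / 2 * x) *\<^sub>R g (1 / 2 + 1 / 2 * x)))"
    by (rule integrable_mult_right)
  moreover have "4 powr A * (indicator {0..1} (1 / 2 + 1 / 2 * x) *\<^sub>R g (1 / 2 + 1 / 2 * x))
     = indicator {-1<..<1} x * (1 - x\<^sup>2) powr A" for x :: real
  proof (cases "-1 < x \<and> x < 1")
    case True
    define u v where "u = 1 / 2 + 1 / 2 * x" and "v = 1 - u"
    have "u > 0" "v > 0" using True by (simp_all add: u_def v_def)
    then have "4 powr A * g u = (4 * (u * v)) powr A"
      unfolding g_def v_def[symmetric] by (simp add: powr_mult)
    also have "4 * (u * v) = 1 - x\<^sup>2"
      by (simp add: u_def v_def field_simps power2_eq_square)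
    finally have "4 powr A * g (1 / 2 + 1 / 2 * x) = (1 - x\<^sup>2) powr A" unfolding u_def .
    moreover have "0 \<le> 1 / 2 + 1 / 2 * x" "1 / 2 + 1 / 2 * x \<le> 1" using True by simp_all
    ultimately show ?thesis using True by (simp add: indicator_def)
  next
    case False
    then have "x = 1 \<or> x = -1 \<or> x < -1 \<or> x > 1" by auto
    then show ?thesis by (auto simp: indicator_def g_def)
  qed
  ultimately show ?thesis by (simp only:)
qed

lemma integrable_ultraspherical_weight_poly:
  fixes A :: real assumes "A > -1"
  shows "integrable lborel (\<lambda>x. indicator {-1<..<1} x * (1 - x\<^sup>2) powr A * poly p x)"
proof -
  have "compact (poly p ` {-1..1})"
    by (intro compact_continuous_image continuous_intros) auto
  then obtain B where B: "\<And>x. -1 \<le> x \<Longrightarrow> x \<le> 1 \<Longrightarrow> norm (poly p x) \<le> B"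
    by (meson bounded_iff compact_imp_bounded atLeastAtMost_iff imageI)
  have "poly p \<in> borel_measurable borel"
    by (intro borel_measurable_continuous_onI continuous_intros)
  note [measurable] = this
  show ?thesis
  proof (rule Bochner_Integration.integrable_bound)
    show "integrable lborel (\<lambda>x. B * (indicator {-1<..<1} x * (1 - x\<^sup>2) powr A))"
      by (intro integrable_mult_right integrable_ultraspherical_weight assms)
    show "AE x in lborel. norm (indicator {-1<..<1} x * (1 - x\<^sup>2) powr A * poly p x)
        \<le> norm (B * (indicator {-1<..<1} x * (1 - x\<^sup>2) powr A))"
    proof (rule AE_I2)
      fix x :: real
      show "norm (indicator {-1<..<1} x * (1 - x\<^sup>2) powr A * poly p x)
        \<le> norm (B * (indicator {-1<..<1} x * (1 - x\<^sup>2) powr A))"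
      proof (cases "-1 < x \<and> x < 1")
        case True
        then have "norm (poly p x) \<le> \<bar>B\<bar>" using B[of x] by simp
        then show ?thesis using True
          by (simp add: indicator_def abs_mult mult.commute[of "\<bar>B\<bar>"] mult_left_mono)
      qed (auto simp: indicator_def)
    qed
  qed measurable
qed

text \<open>Integration by parts; the boundary terms vanish because \<open>A + 1 > 0\<close>.\<close>

lemma ultraspherical_weight_parts:
  fixes A :: real assumes A: "A > -1"
  shows "(\<integral>x. indicator {-1<..<1} x * (1 - x\<^sup>2) powr A
      * poly ([:1, 0, -1:] * pderiv p - smult (2 * (A + 1)) (pX * p)) x \<partial>lborel) = 0"
proof -
  define f where "f x = (1 - x\<^sup>2) powr A * poly ([:1, 0, -1:] * pderiv p - smult (2 * (A + 1)) (pX * p)) x" for x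
  define F where "F x = (1 - x\<^sup>2) powr (A + 1) * poly p x" for x
  have pos: "1 - x\<^sup>2 > 0" if "-1 < x" "x < 1" for x :: real
    using that by (simp add: abs_square_less_1 abs_less_iff)
  have cont: "continuous_on {-1..1} F"
    unfolding F_def using A
    by (intro continuous_intros continuous_on_powr') (auto simp: abs_square_le_1 abs_le_iff)
  have "(LBINT x=ereal (-1)..ereal 1. f x) = 0 - 0"
  proof (rule interval_integral_FTC_integrable[where F = F])
    show "ereal (-1) < ereal 1" by simp
    show "(F has_vector_derivative f x) (at x)" if "ereal (-1) < ereal x" "ereal x < ereal 1" for x
    proof -
      have x: "1 - x\<^sup>2 > 0" using pos that by simp
      have e: "(1 - x\<^sup>2) powr (A + 1) = (1 - x\<^sup>2) powr A * (1 - x\<^sup>2)"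
        using x by (simp add: powr_add)
      have "(A + 1) * (1 - x\<^sup>2) powr (A + 1 - 1) * (- (2 * x)) * poly p x
            + (1 - x\<^sup>2) powr (A + 1) * poly (pderiv p) x = f x"
        unfolding e by (simp add: f_def algebra_simps power2_eq_square)
      moreover have "(F has_real_derivative (A + 1) * (1 - x\<^sup>2) powr (A + 1 - 1) * (- (2 * x)) * poly p x
            + (1 - x\<^sup>2) powr (A + 1) * poly (pderiv p) x) (at x)"
        unfolding F_def using x
        by (auto intro!: derivative_eq_intros simp: powr_diff field_simps)
      ultimately show ?thesis
        unfolding has_real_derivative_iff_has_vector_derivative[symmetric] by simp
    qed
    show "isCont f x" if "ereal (-1) < ereal x" "ereal x < ereal 1" for x
      unfolding f_def using pos[of x] that by (intro continuous_intros) auto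
    show "set_integrable lborel (einterval (ereal (-1)) (ereal 1)) f"
      using integrable_ultraspherical_weight_poly[OF A, of "[:1, 0, -1:] * pderiv p - smult (2 * (A + 1)) (pX * p)"]
      by (simp add: set_integrable_def f_def einterval_eq mult.assoc)
    have "F (-1) = 0" "F 1 = 0" using A by (simp_all add: F_def)
    then have "(F \<longlongrightarrow> 0) (at_right (-1))" "(F \<longlongrightarrow> 0) (at_left 1)"
      using continuous_on_Icc_at_rightD[OF cont] continuous_on_Icc_at_leftD[OF cont] by simp_all
    then show "((F \<circ> real_of_ereal) \<longlongrightarrow> 0) (at_right (ereal (-1)))"
      "((F \<circ> real_of_ereal) \<longlongrightarrow> 0) (at_left (ereal 1))"
      by (simp_all only: ereal_tendsto_simps)
  qed
  then show ?thesis
    by (simp add: interval_lebesgue_integral_def set_lebesgue_integral_def einterval_eq f_def mult.assoc)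
qed

text \<open>The recurrence of the moments is the previous identity for \<open>p = x\<^sup>n\<close>.\<close>

lemma ultraspherical_measure_poly:
  fixes A :: real assumes A: "A > -1"
  defines "M \<equiv> \<lambda>p. \<integral>x. poly p x \<partial>ultraspherical_measure A"
  shows "integrable (ultraspherical_measure A) (poly p)"
    and "real n * (M (pX ^ (n - 1)) - M (pX ^ Suc n)) = (2 * A + 2) * M (pX ^ Suc n)"
    and "M 1 > 0"
proof -
  define C where "C = Gamma (2 * A + 2) / (2 powr (2 * A + 1) * (Gamma (A + 1))\<^sup>2)"
  have C: "C > 0" unfolding C_def using A
    by (intro divide_pos_pos mult_pos_pos Gamma_real_pos zero_less_power) auto
  let ?w = "\<lambda>x. C * (indicator {-1<..<1} x * (1 - x\<^sup>2) powr A)"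
  have U: "ultraspherical_measure A = density lborel (\<lambda>x. ennreal (?w x))"
    unfolding ultraspherical_measure_def C_def by (simp add: mult_ac)
  have meas: "?w \<in> borel_measurable lborel" by measurable
  have nonneg: "AE x in lborel. 0 \<le> ?w x" using C by (intro AE_I2) (simp add: indicator_def)
  have pm: "poly q \<in> borel_measurable lborel" for q :: "real poly"
    using borel_measurable_continuous_onI[of "poly q"] by (simp add: continuous_intros)
  have int: "integrable lborel (\<lambda>x. ?w x * poly q x)" for q
    using integrable_mult_right[OF integrable_ultraspherical_weight_poly[OF A, of q], of C] by (simp add: mult_ac)
  show I: "integrable (ultraspherical_measure A) (poly p)" for p
    unfolding U integrable_real_density[OF meas nonneg pm] by (rule int)
  have M: "M q = C * (\<integral>x. indicator {-1<..<1} x * (1 - x\<^sup>2) powr A * poly q x \<partial>lborel)" for q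
    unfolding M_def U integral_real_density[OF meas nonneg pm]
    by (subst integral_mult_right_zero[symmetric]) (simp add: mult_ac)
  have add: "M (p - q) = M p - M q" for p q unfolding M_def by (rule integral_poly_diff[OF I])
  have sm: "M (smult r p) = r * M p" for r p unfolding M_def by (rule integral_poly_smult)
  have "M ([:1, 0, -1:] * pderiv (pX ^ n) - smult (2 * (A + 1)) (pX * pX ^ n)) = 0"
    unfolding M ultraspherical_weight_parts[OF A] by simp
  moreover have "[:1, 0, -1:] * pderiv (pX ^ n) = smult (real n) (pX ^ (n - 1) - pX ^ Suc n)"
  proof -
    have "pderiv pX = 1" by (simp add: pX_def pderiv_pCons)
    then show ?thesis
      unfolding one_minus_sq_times pderiv_power by (cases n) (simp_all add: smult_diff_right)
  qed
  ultimately show "real n * (M (pX ^ (n - 1)) - M (pX ^ Suc n)) = (2 * A + 2) * M (pX ^ Suc n)"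
    by (simp add: add sm algebra_simps)
  have int1: "integrable lborel ?w" using int[of 1] by simp
  have M1: "M 1 = (\<integral>x. ?w x \<partial>lborel)" unfolding M by simp
  have "(\<integral>x. ?w x \<partial>lborel) \<noteq> 0"
  proof
    assume "(\<integral>x. ?w x \<partial>lborel) = 0"
    then have "AE x in lborel. ?w x = 0"
      using integral_nonneg_eq_0_iff_AE[OF int1 nonneg] by simp
    then have "AE x in lborel. x \<notin> {-1<..<1::real}"
    proof eventually_elim
      case (elim x)
      show ?case
      proof
        assume "x \<in> {-1<..<1}"
        moreover then have "1 - x\<^sup>2 > 0" by (simp add: abs_square_less_1 abs_less_iff)
        ultimately show False using elim C by simp
      qed
    qed
    then have "emeasure lborel {-1<..<1::real} = 0"
      by (subst AE_iff_measurable[symmetric, where P = "\<lambda>x. x \<notin> {-1<..<1}"]) auto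
    then show False by simp
  qed
  moreover have "(\<integral>x. ?w x \<partial>lborel) \<ge> 0" by (rule integral_nonneg_AE[OF nonneg])
  ultimately show "M 1 > 0" unfolding M1 less_le by metis
qed

section \<open>Sequences with given recurrence coefficients\<close>

lemma recurrence_eq:
  assumes "recurrence_coeffs P c"
  shows "smult (1 - c n) (P (Suc n)) + smult (c n) (P (n - 1)) = pX * P n"
proof -
  have "\<forall>n. [:0, 1:] * P n = smult (1 - c n) (P (n + 1)) + smult (c n) (P (n - 1))"
    using assms unfolding recurrence_coeffs_def by blast
  then have "[:0, 1:] * P n = smult (1 - c n) (P (n + 1)) + smult (c n) (P (n - 1))" ..
  then show ?thesis unfolding pX_def Suc_eq_plus1 by (rule sym)
qed

lemma recurrence_coeffs_unique:
  assumes "recurrence_coeffs P c" "recurrence_coeffs Q c"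
  shows "P n = Q n"
proof (induction n rule: less_induct)
  case (less n)
  show ?case
  proof (cases n)
    case 0
    then show ?thesis using assms by (simp add: recurrence_coeffs_def)
  next
    case (Suc m)
    have "1 - c m > 0" using assms by (cases m) (auto simp: recurrence_coeffs_def)
    moreover have "smult (1 - c m) (P (Suc m)) + smult (c m) (P (m - 1))
        = smult (1 - c m) (Q (Suc m)) + smult (c m) (Q (m - 1))"
    proof -
      have "P m = Q m" using less[of m] Suc by simp
      then show ?thesis using recurrence_eq[OF assms(1), of m] recurrence_eq[OF assms(2), of m] by simp
    qed
    moreover have "P (m - 1) = Q (m - 1)" using less[of "m - 1"] Suc by simp
    ultimately have "smult (1 - c m) (P (Suc m) - Q (Suc m)) = 0" by (simp add: smult_diff_right)
    then show ?thesis using \<open>1 - c m > 0\<close> Suc by simp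
  qed
qed

lemma recurrence_coeffs_inj:
  assumes "recurrence_coeffs P c" "recurrence_coeffs P c'"
  shows "c n = c' n"
proof -
  interpret rw_recurrence P c by (rule rw_recurrence.intro[OF assms(1)])
  have eq: "smult (1 - c n) (P (Suc n)) + smult (c n) (P (n - 1))
      = smult (1 - c' n) (P (Suc n)) + smult (c' n) (P (n - 1))"
    unfolding recurrence_eq[OF assms(1)] recurrence_eq[OF assms(2)] ..
  have "smult (c n - c' n) (P (Suc n) - P (n - 1))
      = (smult (1 - c' n) (P (Suc n)) + smult (c' n) (P (n - 1)))
        - (smult (1 - c n) (P (Suc n)) + smult (c n) (P (n - 1)))"
    by (simp add: smult_diff_left smult_diff_right)
  then have "smult (c n - c' n) (P (Suc n) - P (n - 1)) = 0" unfolding eq by simp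
  moreover have "P (Suc n) \<noteq> P (n - 1)"
  proof
    assume "P (Suc n) = P (n - 1)"
    then have "degree (P (Suc n)) = degree (P (n - 1))" by (rule arg_cong)
    then show False unfolding degree_P by simp
  qed
  ultimately show ?thesis by simp
qed

fun rec_polys :: "(nat \<Rightarrow> real) \<Rightarrow> nat \<Rightarrow> real poly" where
  "rec_polys c 0 = 1"
| "rec_polys c (Suc 0) = [:0, 1:]"
| "rec_polys c (Suc (Suc n)) = smult (1 / (1 - c (Suc n))) ([:0, 1:] * rec_polys c (Suc n) - smult (c (Suc n)) (rec_polys c n))"

lemma recurrence_coeffs_rec_polys:
  assumes "c 0 = 0" "\<And>n. n \<ge> 1 \<Longrightarrow> 0 < c n \<and> c n < 1"
  shows "recurrence_coeffs (rec_polys c) c"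
proof -
  have "[:0, 1:] * rec_polys c n = smult (1 - c n) (rec_polys c (n + 1)) + smult (c n) (rec_polys c (n - 1))" for n
  proof (cases n)
    case 0
    then show ?thesis using assms(1) by simp
  next
    case (Suc m)
    have "1 - c (Suc m) \<noteq> 0" using assms(2)[of "Suc m"] by simp
    then show ?thesis unfolding Suc by simp
  qed
  then show ?thesis unfolding recurrence_coeffs_def using assms(1)
    by (intro conjI allI impI rec_polys.simps(1)) (simp_all only: assms(2))
qed

text \<open>Take the constant coefficient of the linear map with \<open>P 0 \<mapsto> 1\<close> and \<open>P n \<mapsto> 0\<close> for \<open>n > 0\<close>.\<close>

lemma rw_functional_exists:
  assumes rec: "recurrence_coeffs P c"
  shows "\<exists>L. rw_functional P c L"
proof -
  interpret rw_recurrence P c by (rule rw_recurrence.intro[OF rec])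
  obtain E where E: "Vector_Spaces.linear smult smult E" "\<And>n. E (P n) = (if n = 0 then 1 else 0)"
    using ex1_implies_ex[OF ex1_linear_on_graded_basis[OF degree_P P_nonzero, of "\<lambda>n. if n = 0 then 1 else 0"]]
    by blast
  have "rw_functional P c (\<lambda>p. coeff (E p) 0)"
  proof
    show "coeff (E 1) 0 = 1" using E(2)[of 0] by simp
    show "coeff (E (P (Suc n))) 0 = 0" for n by (simp add: E(2))
    show "coeff (E (p + q)) 0 = coeff (E p) 0 + coeff (E q) 0"
      "coeff (E (smult r p)) 0 = r * coeff (E p) 0" for p q r
      using E(1) by (simp_all add: linear_smult_iff)
  qed
  then show ?thesis by (rule exI[where P = "rw_functional P c"])
qed

text \<open>The coefficients \<open>n / (2 n + s)\<close> make all rows flat for \<open>k = 1\<close>, which determines the moments;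
  they are those of the ultraspherical measure.\<close>

lemma ultraspherical_recurrence:
  fixes s :: real assumes s: "s > -1"
  defines "c \<equiv> \<lambda>n. real n / (2 * real n + s)"
  shows "recurrence_coeffs (ultraspherical ((s - 1) / 2)) c"
proof -
  let ?R = "rec_polys c"
  have rec: "recurrence_coeffs ?R c"
    by (rule recurrence_coeffs_rec_polys) (use s in \<open>simp_all add: c_def field_simps\<close>)
  obtain L where "rw_functional ?R c L" using rw_functional_exists[OF rec] ..
  moreover define k :: nat where "k = 1"
  ultimately interpret rw_askey ?R c L k by (simp add: rw_askey_def)
  have c1: "1 / c 1 - 2 = s" using s by (simp add: c_def)
  have s0: "s\<^sub>0 = s" unfolding s\<^sub>0_def c1 by (simp add: k_def)
  have "good_coeff s\<^sub>0 n" for n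
    using s unfolding good_coeff_def s0 values_at_k_eq_1[OF k_def] by (cases n) (simp_all add: c_def field_simps)
  then have flat: "\<forall>n. flat_at n" using flat_if_all_good by (simp add: k_def)
  define A where "A = (s - 1) / 2"
  have A: "A > -1" using s by (simp add: A_def)
  define M where "M p = (\<integral>x. poly p x \<partial>ultraspherical_measure A)" for p
  note U = ultraspherical_measure_poly[OF A, folded M_def]
  have "2 * A + 2 = s + 1" by (simp add: A_def field_simps)
  then have C: "1 / c 1 - 1 = 2 * A + 2" "2 * A + 2 > 0" using c1 s by simp_all
  have M_eq: "M p = M 1 * L p" for p
  proof (rule functional_eq_by_moments[where C = "2 * A + 2"])
    show "real n * (L (pX ^ (n - 1)) - L (pX ^ Suc n)) = (2 * A + 2) * L (pX ^ Suc n)" for n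
      using L_moments[OF k_def flat] unfolding C .
    show "M (p + q) = M p + M q" "M (smult r p) = r * M p" for p q r
      unfolding M_def by (rule integral_poly_add[OF U(1)] integral_poly_smult)+
  qed (rule L_add L_smult L_one U(2) C(2))+
  have "ops (ultraspherical_measure A) = ?R"
  proof (rule ops_eqI)
    show "m \<noteq> n \<Longrightarrow> (\<integral>x. poly (?R m * ?R n) x \<partial>ultraspherical_measure A) = 0" for m n
      unfolding M_def[symmetric] by (subst M_eq) (simp add: L_P_P)
    show "(\<integral>x. poly (?R n * ?R n) x \<partial>ultraspherical_measure A) \<noteq> 0" for n
      unfolding M_def[symmetric] using U(3) h_pos[of n]
      by (subst M_eq) (simp add: L_P_P del: h.simps)
  qed (use U(1) degree_P poly_P_1 in auto)
  then show ?thesis unfolding ultraspherical_def A_def[symmetric] using rec by simp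
qed

section \<open>Sieved and ultraspherical random walk polynomials\<close>

theorem theorem3p2:
  fixes \<mu> :: "real measure" and P :: "nat \<Rightarrow> real poly" and c :: "nat \<Rightarrow> real" and k :: nat
  assumes "rwps \<mu> P" and "recurrence_coeffs P c"
  defines "cond_ii \<equiv>
      \<forall>n\<ge>1. askey_wilson k (P n) = smult (poly (askey_wilson k (P n)) 1) (star_polys \<mu> (n - 1))"
    and "cond_iii \<equiv>
      \<forall>n\<ge>2. \<forall>j\<le>n - 2.
        (\<integral>x. poly ([:1, 0, -1:] * askey_wilson k (P n)) x * poly (P j) x \<partial>\<mu>) = 0"
    and "cond_iv \<equiv>
      (\<forall>n\<ge>1. kappa_coeff \<mu> P k (n + 2) (n - 1) = sigma_coeff \<mu> P k (n + 2)) \<and>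
      (\<forall>n\<ge>1. \<exists>m\<in>{0..(n - 1) div 2}. kappa_coeff \<mu> P k (n + 4) (n - 1 - 2 * m) = sigma_coeff \<mu> P k (n + 4))"
  shows "(k \<ge> 2 \<longrightarrow>
            (sieved k c \<longleftrightarrow> cond_ii) \<and> (cond_ii \<longleftrightarrow> cond_iii) \<and> (cond_iii \<longleftrightarrow> cond_iv)) \<and>
         (k = 1 \<longrightarrow>
            ((\<forall>n. P n = ultraspherical (1 / (2 * c 1) - 3 / 2) n) \<longleftrightarrow> cond_ii) \<and>
            (cond_ii \<longleftrightarrow> cond_iii) \<and> (cond_iii \<longleftrightarrow> cond_iv))"
proof -
  have om: "orthogonalization_measure \<mu>" and nops: "normalized_ops \<mu> P"
    using assms(1) by (simp_all add: rwps_def)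
  interpret prob_space \<mu> using om by (simp add: orthogonalization_measure_def)
  define L where "L p = (\<integral>x. poly p x \<partial>\<mu>)" for p
  have P0: "P 0 = 1" using assms(2) by (simp add: recurrence_coeffs_def)
  interpret rw_askey P c L k
  proof
    have "(\<integral>x. poly (P (Suc n)) x * poly (P 0) x \<partial>\<mu>) = 0" for n
      using nops unfolding normalized_ops_def by blast
    then show "L (P (Suc n)) = 0" for n by (simp add: L_def P0)
    show "L (p + q) = L p + L q" "L (smult r p) = r * L p" for p q r
      unfolding L_def by (rule integral_poly_add[OF integrable_poly[OF om]] integral_poly_smult)+
    show "L 1 = 1" using prob_space by (simp add: L_def)
  qed (rule assms(2))
  have L_mult: "(\<integral>x. poly p x * poly q x \<partial>\<mu>) = L (p * q)" for p q
    unfolding L_def by (rule Bochner_Integration.integral_cong) simp_all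
  have \<kappa>: "kappa_coeff \<mu> P k n j = \<kappa> n j" for n j
    unfolding kappa_coeff_def \<kappa>_def L_mult ..
  have \<sigma>: "sigma_coeff \<mu> P k (Suc n) = \<sigma> (Suc n)" for n
    by (simp add: sigma_coeff_def \<kappa> \<kappa>_Suc)
  have "star_polys \<mu> = P_star"
    unfolding star_polys_def
  proof (rule ops_eqI)
    show "(\<integral>x. poly (P_star m * P_star n) x \<partial>star_measure \<mu>) = 0" if "m \<noteq> n" for m n
      unfolding star_measure_poly(2)[OF om] L_def[symmetric] by (rule P_star_orthogonal(3)[OF that])
    show "(\<integral>x. poly (P_star n * P_star n) x \<partial>star_measure \<mu>) \<noteq> 0" for n
      unfolding star_measure_poly(2)[OF om] L_def[symmetric] by (rule P_star_orthogonal(4))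
  qed (rule P_star_orthogonal(1,2) star_measure_poly(1)[OF om])+
  moreover have Suc1: "(\<forall>n\<ge>1. Q n) \<longleftrightarrow> (\<forall>n. Q (Suc n))" for Q :: "nat \<Rightarrow> bool"
    by (auto simp: Suc_le_eq gr0_conv_Suc)
  ultimately have ii: "cond_ii \<longleftrightarrow> (\<forall>n. flat_at n)"
    unfolding cond_ii_def flat_iff_multiple Suc1 diff_Suc_1 by simp
  have iii: "cond_iii \<longleftrightarrow> (\<forall>n. flat_at n)"
  proof -
    have Suc2: "(\<forall>n\<ge>2. Q n) \<longleftrightarrow> (\<forall>n. Q (Suc (Suc n)))" for Q :: "nat \<Rightarrow> bool"
    proof (intro iffI allI impI)
      fix n :: nat assume *: "\<forall>n. Q (Suc (Suc n))" "2 \<le> n"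
      then have "Suc (Suc (n - 2)) = n" by simp
      with *(1) show "Q n" by metis
    qed simp
    have "cond_iii \<longleftrightarrow> (\<forall>n. \<forall>j\<le>n. L ([:1, 0, -1:] * D (P (Suc (Suc n))) * P j) = 0)"
      unfolding cond_iii_def L_mult Suc2 by (simp only: numeral_2_eq_2 diff_Suc_Suc diff_zero)
    then show ?thesis unfolding flat_iff_orthogonal .
  qed
  have iv: "cond_iv \<longleftrightarrow> two_flat"
  proof -
    have eqs: "Suc n + 2 = n + 3" "Suc n + 4 = n + 5" "Suc n - 1 = n" for n by simp_all
    have \<sigma>3: "sigma_coeff \<mu> P k (n + 3) = \<sigma> (n + 3)" for n
      using \<sigma>[of "n + 2"] by (simp add: numeral_eq_Suc)
    have \<sigma>5: "sigma_coeff \<mu> P k (n + 5) = \<sigma> (n + 5)" for n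
      using \<sigma>[of "n + 4"] by (simp add: numeral_eq_Suc)
    show ?thesis unfolding cond_iv_def two_flat_def Suc1 \<kappa>
      by (simp only: eqs \<sigma>3 \<sigma>5 Bex_def atLeastAtMost_iff le0 simp_thms)
  qed
  have flat_two: "(\<forall>n. flat_at n) \<longleftrightarrow> two_flat"
    and flat_good: "(\<forall>n. flat_at n) \<longleftrightarrow> (\<forall>n>0. good_coeff s\<^sub>0 n)" if "k \<ge> 1"
    using flat_if_all_good[OF that] two_flat_if_flat all_good_if_two_flat[OF that] by blast+
  have sieved: "sieved k c \<longleftrightarrow> (\<forall>n. flat_at n)" if "k \<ge> 2"
  proof -
    have "s\<^sub>0 = 0" using that by (simp add: s\<^sub>0_def)
    then show ?thesis
      using that flat_good good_coeff_0_iff[OF that] unfolding sieved_def by (auto simp: Suc_le_eq)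
  qed
  have ultra: "(\<forall>n. P n = ultraspherical (1 / (2 * c 1) - 3 / 2) n) \<longleftrightarrow> (\<forall>n. flat_at n)" if k: "k = 1"
  proof -
    define s where "s = 1 / c 1 - 2"
    have "0 < c 1" "c 1 < 1" using c_pos[of 0] c_less_1[of 1] by simp_all
    then have s: "s > -1" by (simp add: s_def field_simps)
    define c' where "c' n = real n / (2 * real n + s)" for n
    have A: "1 / (2 * c 1) - 3 / 2 = (s - 1) / 2" by (simp add: s_def field_simps)
    have rec': "recurrence_coeffs (ultraspherical (1 / (2 * c 1) - 3 / 2)) c'"
      unfolding A c'_def by (rule ultraspherical_recurrence[OF s])
    have "s\<^sub>0 = s" unfolding s\<^sub>0_def s_def using k by simp
    have good: "good_coeff s\<^sub>0 n \<longleftrightarrow> c n = c' n" if "n > 0" for n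
    proof -
      have "2 * real n + s > 0" using s that by linarith
      then show ?thesis
        unfolding good_coeff_def c'_def \<open>s\<^sub>0 = s\<close> by (auto simp: values_at_k_eq_1[OF k] field_simps)
    qed
    have "(\<forall>n. P n = ultraspherical (1 / (2 * c 1) - 3 / 2) n) \<longleftrightarrow> c = c'"
    proof
      assume "\<forall>n. P n = ultraspherical (1 / (2 * c 1) - 3 / 2) n"
      then have "P = ultraspherical (1 / (2 * c 1) - 3 / 2)" by (simp add: fun_eq_iff)
      with rec' have "recurrence_coeffs P c'" by simp
      then show "c = c'" using recurrence_coeffs_inj[OF assms(2)] by blast
    next
      assume "c = c'"
      with rec' have "recurrence_coeffs (ultraspherical (1 / (2 * c 1) - 3 / 2)) c" by simp
      then show "\<forall>n. P n = ultraspherical (1 / (2 * c 1) - 3 / 2) n"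
        using recurrence_coeffs_unique[OF assms(2)] by blast
    qed
    also have "\<dots> \<longleftrightarrow> (\<forall>n>0. c n = c' n)"
    proof
      assume *: "\<forall>n>0. c n = c' n"
      show "c = c'"
      proof
        fix n show "c n = c' n" using * by (cases n) (simp_all add: c'_def)
      qed
    qed simp
    also have "\<dots> \<longleftrightarrow> (\<forall>n. flat_at n)" using flat_good good k by simp
    finally show ?thesis .
  qed
  show ?thesis unfolding ii iii iv
  proof (intro conjI impI)
    show "sieved k c \<longleftrightarrow> (\<forall>n. flat_at n)" "(\<forall>n. flat_at n) \<longleftrightarrow> two_flat" if "k \<ge> 2"
      using sieved[OF that] flat_two that by simp_all
    show "(\<forall>n. P n = ultraspherical (1 / (2 * c 1) - 3 / 2) n) \<longleftrightarrow> (\<forall>n. flat_at n)"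
      "(\<forall>n. flat_at n) \<longleftrightarrow> two_flat" if "k = 1"
      using ultra[OF that] flat_two that by simp_all
  qed (rule refl)+
qed

end
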